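(* Let $\phi: F\to F$ be an injective endomorphism. Then there is a unique maximal $[\phi]$-fixed free factor system $\mathcal A$ of $F$. Precisely, $\mathcal A$ carries every conjugacy class in $F$ with an infinite $[\phi]$-tail and every finitely generated $[\phi]$-fixed subgroup system.
   Context: $F$ is a free group of finite rank at least $2$. A nontrivial subgroup system of $F$ is a nonempty finite collection of nontrivial subgroups $\mathcal A=\{A_1,\dots,A_l\}$ (its components); it is finitely generated if its components are. A nontrivial free factor system is a nonempty finite collection of nontrivial free factors of $F$ which generate their free product $A_1*\cdots*A_l$, with this product a free factor of $F$. The trivial system is the collection consisting of the trivial subgroup. A subgroup system $\mathcal A$ carries a subgroup system $\mathcal B$ if for every $B\in\mathcal B$ there are $A\in\mathcal A$, $x\in F$ with $B\le xAx^{-1}$; for free factor systems this is written $\mathcal B\preceq\mathcal A$. $\mathcal A$ carries a conjugacy class $[g]$ if $g\in xAx^{-1}$ for some $A\in\mathcal A$, $x\in F$. Free factor systems are considered up to the equivalence relation $\mathcal A\preceq\mathcal B$ and $\mathcal B\preceq\mathcal A$; maximality and uniqueness refer to the induced partial order. A subgroup system $\mathcal A=\{A_1,\dots,A_l\}$ is $[\phi]$-invariant if it carries $\phi(\mathcal A)=\{\phi(A_1),\dots,\phi(A_l)\}$, i.e. $\phi(A_i)\le x_iA_{\sigma(i)}x_i^{-1}$ for some elements $x_i\in F$ and a function $\sigma$ on indices. It is $[\phi]$-fixed if moreover $\sigma$ is a permutation and $\phi(A_i)$ is conjugate in $F$ to $A_{\sigma(i)}$ for all $i$. A conjugacy class $[g]$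 in $F$ has an infinite $[\phi]$-tail if for every $n\ge1$ there is a conjugacy class $[g_n]$ in $F$ with $[\phi^n(g_n)]=[g]$. *)

theory Defs
  imports "HOL-Algebra.Algebra"
begin

section \<open>Free groups and free products\<close>

text \<open>A word in \<^term>\<open>S\<close> is a list of signed letters; the letter \<open>(x, True)\<close> stands for \<open>x\<close> and
  \<open>(x, False)\<close> for its inverse.\<close>

definition reduced_word :: "('a \<times> bool) list \<Rightarrow> bool" where
  "reduced_word w \<longleftrightarrow> successively (\<lambda>(x, b) (y, c). x = y \<longrightarrow> b = c) w"

definition word_value :: "('a, 'm) monoid_scheme \<Rightarrow> ('a \<times> bool) list \<Rightarrow> 'a" where
  "word_value G w =
     foldr (\<otimes>\<^bsub>G\<^esub>) (map (\<lambda>(x, b). if b then x else inv\<^bsub>G\<^esub> x) w) \<one>\<^bsub>G\<^esub>"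

definition free_basis :: "('a, 'm) monoid_scheme \<Rightarrow> 'a set \<Rightarrow> bool" where
  "free_basis G S \<longleftrightarrow> S \<subseteq> carrier G \<and> generate G S = carrier G \<and>
     (\<forall>w. w \<noteq> [] \<longrightarrow> fst ` set w \<subseteq> S \<longrightarrow> reduced_word w \<longrightarrow> word_value G w \<noteq> \<one>\<^bsub>G\<^esub>)"

text \<open>A family of subgroups generates its free product: by the normal form theorem, the canonical
  homomorphism from the external free product to \<^term>\<open>G\<close> is injective iff no nonempty
  alternating product of nontrivial elements is trivial.\<close>

definition generates_free_product ::
    "('a, 'm) monoid_scheme \<Rightarrow> 'i set \<Rightarrow> ('i \<Rightarrow> 'a set) \<Rightarrow> bool" where
  "generates_free_product G I H \<longleftrightarrow> (\<forall>i\<in>I. subgroup (H i) G) \<and>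
     (\<forall>w :: ('i \<times> 'a) list. w \<noteq> [] \<longrightarrow>
        (\<forall>(i, a)\<in>set w. i \<in> I \<and> a \<in> H i \<and> a \<noteq> \<one>\<^bsub>G\<^esub>) \<longrightarrow>
        successively (\<lambda>p q. fst p \<noteq> fst q) w \<longrightarrow>
        foldr (\<otimes>\<^bsub>G\<^esub>) (map snd w) \<one>\<^bsub>G\<^esub> \<noteq> \<one>\<^bsub>G\<^esub>)"

definition is_free_product ::
    "('a, 'm) monoid_scheme \<Rightarrow> 'i set \<Rightarrow> ('i \<Rightarrow> 'a set) \<Rightarrow> bool" where
  "is_free_product G I H \<longleftrightarrow>
     generates_free_product G I H \<and> generate G (\<Union>i\<in>I. H i) = carrier G"

definition free_factor :: "('a, 'm) monoid_scheme \<Rightarrow> 'a set \<Rightarrow> bool" where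
  "free_factor G H \<longleftrightarrow> (\<exists>K. is_free_product G (UNIV :: bool set) (\<lambda>b. if b then H else K))"

section \<open>Subgroup systems\<close>

definition nontrivial_subgroup_system :: "('a, 'm) monoid_scheme \<Rightarrow> 'a set set \<Rightarrow> bool" where
  "nontrivial_subgroup_system G \<A> \<longleftrightarrow>
     finite \<A> \<and> \<A> \<noteq> {} \<and> (\<forall>A\<in>\<A>. subgroup A G \<and> A \<noteq> {\<one>\<^bsub>G\<^esub>})"

definition trivial_system :: "('a, 'm) monoid_scheme \<Rightarrow> 'a set set" where
  "trivial_system G = {{\<one>\<^bsub>G\<^esub>}}"

definition subgroup_system :: "('a, 'm) monoid_scheme \<Rightarrow> 'a set set \<Rightarrow> bool" where
  "subgroup_system G \<A> \<longleftrightarrow> nontrivial_subgroup_system G \<A> \<or> \<A> = trivial_system G"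

definition finitely_generated_system :: "('a, 'm) monoid_scheme \<Rightarrow> 'a set set \<Rightarrow> bool" where
  "finitely_generated_system G \<A> \<longleftrightarrow>
     (\<forall>A\<in>\<A>. \<exists>S. finite S \<and> S \<subseteq> carrier G \<and> A = generate G S)"

definition nontrivial_free_factor_system :: "('a, 'm) monoid_scheme \<Rightarrow> 'a set set \<Rightarrow> bool" where
  "nontrivial_free_factor_system G \<A> \<longleftrightarrow>
     finite \<A> \<and> \<A> \<noteq> {} \<and> (\<forall>A\<in>\<A>. free_factor G A \<and> A \<noteq> {\<one>\<^bsub>G\<^esub>}) \<and>
     generates_free_product G \<A> (\<lambda>A. A) \<and> free_factor G (generate G (\<Union>\<A>))"

definition free_factor_system :: "('a, 'm) monoid_scheme \<Rightarrow> 'a set set \<Rightarrow> bool" where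
  "free_factor_system G \<A> \<longleftrightarrow> nontrivial_free_factor_system G \<A> \<or> \<A> = trivial_system G"

definition conj_subgroup :: "('a, 'm) monoid_scheme \<Rightarrow> 'a \<Rightarrow> 'a set \<Rightarrow> 'a set" where
  "conj_subgroup G x A = x <#\<^bsub>G\<^esub> (A #>\<^bsub>G\<^esub> inv\<^bsub>G\<^esub> x)"

definition conj_class :: "('a, 'm) monoid_scheme \<Rightarrow> 'a \<Rightarrow> 'a set" where
  "conj_class G g = {x \<otimes>\<^bsub>G\<^esub> g \<otimes>\<^bsub>G\<^esub> inv\<^bsub>G\<^esub> x | x. x \<in> carrier G}"

definition carries :: "('a, 'm) monoid_scheme \<Rightarrow> 'a set set \<Rightarrow> 'a set set \<Rightarrow> bool" where
  "carries G \<A> \<B> \<longleftrightarrow> (\<forall>B\<in>\<B>. \<exists>A\<in>\<A>. \<exists>x\<in>carrier G. B \<subseteq> conj_subgroup G x A)"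

text \<open>\<^term>\<open>\<A>\<close> carries the conjugacy class of \<^term>\<open>g\<close>; this does not depend on the
  representative \<^term>\<open>g\<close>.\<close>

definition carries_class :: "('a, 'm) monoid_scheme \<Rightarrow> 'a set set \<Rightarrow> 'a \<Rightarrow> bool" where
  "carries_class G \<A> g \<longleftrightarrow> (\<exists>A\<in>\<A>. \<exists>x\<in>carrier G. g \<in> conj_subgroup G x A)"

definition equivalent_systems :: "('a, 'm) monoid_scheme \<Rightarrow> 'a set set \<Rightarrow> 'a set set \<Rightarrow> bool" where
  "equivalent_systems G \<A> \<B> \<longleftrightarrow> carries G \<A> \<B> \<and> carries G \<B> \<A>"

section \<open>Invariance under an endomorphism\<close>

text \<open>The components of a system index themselves, so the function on indices is a self-map
  \<^term>\<open>\<sigma>\<close> of \<^term>\<open>\<A>\<close>.\<close>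

definition invariant_via ::
    "('a, 'm) monoid_scheme \<Rightarrow> ('a \<Rightarrow> 'a) \<Rightarrow> 'a set set \<Rightarrow> ('a set \<Rightarrow> 'a set) \<Rightarrow> bool" where
  "invariant_via G \<phi> \<A> \<sigma> \<longleftrightarrow>
     (\<forall>A\<in>\<A>. \<sigma> A \<in> \<A> \<and> (\<exists>x\<in>carrier G. \<phi> ` A \<subseteq> conj_subgroup G x (\<sigma> A)))"

definition fixed_system :: "('a, 'm) monoid_scheme \<Rightarrow> ('a \<Rightarrow> 'a) \<Rightarrow> 'a set set \<Rightarrow> bool" where
  "fixed_system G \<phi> \<A> \<longleftrightarrow>
     (\<exists>\<sigma>. invariant_via G \<phi> \<A> \<sigma> \<and> bij_betw \<sigma> \<A> \<A> \<and>
        (\<forall>A\<in>\<A>. \<exists>x\<in>carrier G. \<phi> ` A = conj_subgroup G x (\<sigma> A)))"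

definition infinite_tail :: "('a, 'm) monoid_scheme \<Rightarrow> ('a \<Rightarrow> 'a) \<Rightarrow> 'a \<Rightarrow> bool" where
  "infinite_tail G \<phi> g \<longleftrightarrow>
     (\<forall>n\<ge>1. \<exists>h\<in>carrier G. conj_class G ((\<phi> ^^ n) h) = conj_class G g)"

text \<open>Maximality for the partial order that \<^const>\<open>carries\<close> induces on equivalence classes of free
  factor systems, expressed on representatives.\<close>

definition maximal_fixed_free_factor_system ::
    "('a, 'm) monoid_scheme \<Rightarrow> ('a \<Rightarrow> 'a) \<Rightarrow> 'a set set \<Rightarrow> bool" where
  "maximal_fixed_free_factor_system G \<phi> \<A> \<longleftrightarrow>
     free_factor_system G \<A> \<and> fixed_system G \<phi> \<A> \<and>
     (\<forall>\<B>. free_factor_system G \<B> \<longrightarrow> fixed_system G \<phi> \<B> \<longrightarrow> carries G \<B> \<A> \<longrightarrow>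
        equivalent_systems G \<A> \<B>)"

end

(* Write H n for the image of \<phi> ^^ n and let F act by left translation on the inverse limit of the
   coset spaces F / H n. A nontrivial subgroup that is contained in a conjugate of every H n fixes a
   point of the limit, by Koenig's lemma, since an element other than 1 fixes only finitely many
   cosets of the finitely generated group H n. The map \<phi> acts on the limit, it permutes the orbits
   and it carries the stabilizer of a point onto the stabilizer of its image. The maximal system
   consists of the stabilizers of representatives of the orbits with nontrivial stabilizer.

   Distinct points of the limit have distinct components at all deep levels. Finite pieces of the
   Schreier graphs of inequivalent stabilizers therefore embed disjointly in the Schreier graph of
   H n, for n large, and a spanning forest of the pieces extends to a spanning tree. So the Schreier
   generators of the stabilizers are, up to conjugation, disjoint parts of a basis of H n. As H n has
   the rank of F, there are only finitely many of them, and taking all of them shows that conjugates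
   of the stabilizers are generated by disjoint blocks of a basis of H n. Pulling back along \<phi> ^^ n
   gives a free factor system of F. *)
theory Submission
  imports Defs
begin

section \<open>Words\<close>

text \<open>The stabilizers are not known in advance to be finitely generated, and their Schreier
  graphs may be infinite. The argument becomes finite because a Schreier generator depends only on
  two vertices of the transversal: the start of its edge and the representative of the end. Finitely
  many generators therefore live on a finite subtree, and finite subtrees embed. The bound
  \<open>card S\<close> is the same for every finite set of generators, so it bounds the generators
  of all inequivalent stabilizers together; a set of inequivalent points of greatest cardinality
  then exists, and one embedding serves all its generators. The embedding conjugates each stabilizer
  by its own element \<open>c C\<close>, so the blocks belong to conjugates inside
  \<open>H n\<close>. A point whose component at level \<open>n\<close> is \<open>H n\<close> is the
  \<open>n\<close>-fold shift of another point, and the stabilizer of that point is exactly the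
  pullback; these pulled-back points are the final representatives. Their orbits are permuted
  because shifting is injective on orbits and there are finitely many of them.\<close>

definition flip :: "'a \<times> bool \<Rightarrow> 'a \<times> bool" where
  "flip l = (fst l, \<not> snd l)"

definition inverse_word :: "('a \<times> bool) list \<Rightarrow> ('a \<times> bool) list" where
  "inverse_word w = rev (map flip w)"

primrec free_reduction :: "('a \<times> bool) list \<Rightarrow> ('a \<times> bool) list" where
  "free_reduction [] = []"
| "free_reduction (l # w) =
     (case free_reduction w of [] \<Rightarrow> [l] | m # v \<Rightarrow> if m = flip l then v else l # m # v)"

lemma fst_flip [simp]: "fst (flip l) = fst l"
  and snd_flip [simp]: "snd (flip l) \<longleftrightarrow> \<not> snd l"
  and flip_flip [simp]: "flip (flip l) = l"
  and flip_Pair [simp]: "flip (x, b) = (x, \<not> b)"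
  by (auto simp: flip_def)

lemma reduced_word_iff: "reduced_word w \<longleftrightarrow> successively (\<lambda>l m. m \<noteq> flip l) w"
proof -
  have "(\<lambda>(x::'a, b) (y, c). x = y \<longrightarrow> b = c) = (\<lambda>l m. m \<noteq> flip l)"
    by (auto simp: fun_eq_iff flip_def)
  then show ?thesis by (simp add: reduced_word_def)
qed

lemma reduced_Nil [simp]: "reduced_word []"
  and reduced_single [simp]: "reduced_word [l]"
  by (auto simp: reduced_word_iff)

lemma reduced_Cons: "reduced_word (l # w) \<longleftrightarrow> w = [] \<or> hd w \<noteq> flip l \<and> reduced_word w"
  by (auto simp: reduced_word_iff successively_Cons)

lemma reduced_append:
  "reduced_word (u @ v) \<longleftrightarrow>
     reduced_word u \<and> reduced_word v \<and> (u = [] \<or> v = [] \<or> hd v \<noteq> flip (last u))"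
  by (auto simp: reduced_word_iff successively_append_iff)

lemma reduced_snoc: "reduced_word (w @ [l]) \<longleftrightarrow> reduced_word w \<and> (w = [] \<or> last w \<noteq> flip l)"
  by (auto simp: reduced_append)

lemma reduced_inverse_word [simp]: "reduced_word (inverse_word w) \<longleftrightarrow> reduced_word w"
  by (auto simp: inverse_word_def reduced_word_iff successively_map intro!: successively_cong)

lemma inverse_word_Nil_iff [simp]: "inverse_word w = [] \<longleftrightarrow> w = []"
  by (simp add: inverse_word_def)

lemma hd_inverse_word: "w \<noteq> [] \<Longrightarrow> hd (inverse_word w) = flip (last w)"
  by (simp add: inverse_word_def hd_rev last_map)

lemma last_inverse_word: "w \<noteq> [] \<Longrightarrow> last (inverse_word w) = flip (hd w)"
  by (simp add: inverse_word_def last_rev hd_map)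

lemma fst_set_inverse_word [simp]: "fst ` set (inverse_word w) = fst ` set w"
  by (simp add: inverse_word_def image_image)

lemma reduced_free_reduction: "reduced_word (free_reduction w)"
  by (induction w) (auto simp: reduced_Cons split: list.splits)

lemma set_free_reduction: "set (free_reduction w) \<subseteq> set w"
  by (induction w) (auto split: list.splits)

definition occurrences :: "'a set \<Rightarrow> ('a \<times> bool) list \<Rightarrow> nat" where
  "occurrences C w = length (filter (\<lambda>l. fst l \<in> C) w)"

lemma occurrences_Nil [simp]: "occurrences C [] = 0"
  and occurrences_Cons [simp]:
    "occurrences C (l # w) = (if fst l \<in> C then 1 else 0) + occurrences C w"
  and occurrences_append [simp]: "occurrences C (u @ v) = occurrences C u + occurrences C v"
  by (auto simp: occurrences_def)

text \<open>A cancelled pair consists of two letters over the same generator, so it changes each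
  count by 0 or 2. These parities later provide the homomorphisms to the group of order two that
  bound the rank.\<close>

lemma even_occurrences_free_reduction:
  "even (occurrences C (free_reduction w)) \<longleftrightarrow> even (occurrences C w)"
  by (induction w) (auto split: list.splits if_splits)

section \<open>Values of words and free subsets of a group\<close>

context group
begin

lemma mult_inv_cancel [simp]: "x \<in> carrier G \<Longrightarrow> y \<in> carrier G \<Longrightarrow> x \<otimes> (inv x \<otimes> y) = y"
  and inv_mult_cancel [simp]: "x \<in> carrier G \<Longrightarrow> y \<in> carrier G \<Longrightarrow> inv x \<otimes> (x \<otimes> y) = y"
  by (simp_all add: m_assoc [symmetric])

lemmas group_word_simps = m_assoc inv_mult_group

definition letter_value :: "'a \<times> bool \<Rightarrow> 'a" where
  "letter_value l = (if snd l then fst l else inv (fst l))"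

lemma letter_value_Pair [simp]: "letter_value (x, b) = (if b then x else inv x)"
  by (simp add: letter_value_def)

lemma letter_value_closed [simp]: "fst l \<in> carrier G \<Longrightarrow> letter_value l \<in> carrier G"
  by (simp add: letter_value_def)

lemma letter_value_flip: "fst l \<in> carrier G \<Longrightarrow> letter_value (flip l) = inv (letter_value l)"
  by (simp add: letter_value_def)

lemma word_value_Nil [simp]: "word_value G [] = \<one>"
  and word_value_Cons [simp]: "word_value G (l # w) = letter_value l \<otimes> word_value G w"
  by (simp_all add: word_value_def letter_value_def split_beta)

lemma word_value_closed [simp]: "fst ` set w \<subseteq> carrier G \<Longrightarrow> word_value G w \<in> carrier G"
  by (induction w) auto

lemma word_value_append:
  "fst ` set u \<subseteq> carrier G \<Longrightarrow> fst ` set v \<subseteq> carrier G \<Longrightarrow>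
     word_value G (u @ v) = word_value G u \<otimes> word_value G v"
  by (induction u) (auto simp: m_assoc)

lemma word_value_inverse_word:
  "fst ` set w \<subseteq> carrier G \<Longrightarrow> word_value G (inverse_word w) = inv (word_value G w)"
proof (induction w)
  case (Cons l w)
  have "inverse_word (l # w) = inverse_word w @ [flip l]" by (simp add: inverse_word_def)
  then show ?case
    using Cons by (simp add: word_value_append letter_value_flip inv_mult_group)
qed (simp add: inverse_word_def)

lemma word_value_free_reduction:
  "fst ` set w \<subseteq> carrier G \<Longrightarrow> word_value G (free_reduction w) = word_value G w"
proof (induction w)
  case (Cons l w)
  have "fst ` set (free_reduction w) \<subseteq> carrier G"
    using Cons.prems set_free_reduction [of w] by auto
  then show ?case
    using Cons by (cases "free_reduction w") (auto simp: letter_value_flip simp flip: Cons.IH)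
qed simp

text \<open>A basis of the subgroup that it generates, which may be proper: the bases of the
  subgroups \<open>H n\<close> are of this kind.\<close>

definition free_set :: "'a set \<Rightarrow> bool" where
  "free_set B \<longleftrightarrow> B \<subseteq> carrier G \<and>
     (\<forall>w. w \<noteq> [] \<longrightarrow> fst ` set w \<subseteq> B \<longrightarrow> reduced_word w \<longrightarrow> word_value G w \<noteq> \<one>)"

lemma free_basis_iff: "free_basis G B \<longleftrightarrow> free_set B \<and> generate G B = carrier G"
  by (auto simp: free_basis_def free_set_def)

lemma generate_eq_word_values:
  assumes "B \<subseteq> carrier G"
  shows "generate G B = word_value G ` {w. fst ` set w \<subseteq> B}"
proof
  show "generate G B \<subseteq> word_value G ` {w. fst ` set w \<subseteq> B}"
  proof
    fix x assume "x \<in> generate G B"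
    then show "x \<in> word_value G ` {w. fst ` set w \<subseteq> B}"
    proof induction
      case one
      show ?case by (rule image_eqI [of _ _ "[]"]) auto
    next
      case (incl h)
      then show ?case using assms by (intro image_eqI [of _ _ "[(h, True)]"]) auto
    next
      case (inv h)
      then show ?case using assms by (intro image_eqI [of _ _ "[(h, False)]"]) auto
    next
      case (eng h1 h2)
      then obtain u v where "fst ` set u \<subseteq> B" "h1 = word_value G u"
        "fst ` set v \<subseteq> B" "h2 = word_value G v" by auto
      then show ?case
        using assms by (intro image_eqI [of _ _ "u @ v"]) (auto simp: word_value_append)
    qed
  qed
  have "word_value G w \<in> generate G B" if "fst ` set w \<subseteq> B" for w
    using that
  proof (induction w)
    case (Cons l w)
    have "letter_value l \<in> generate G B"
      using Cons.prems by (auto simp: letter_value_def intro: generate.intros)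
    then show ?case using Cons by (auto intro: generate.eng)
  qed (auto intro: generate.one)
  then show "word_value G ` {w. fst ` set w \<subseteq> B} \<subseteq> generate G B" by auto
qed

lemma generate_reduced_wordE:
  assumes "B \<subseteq> carrier G" "x \<in> generate G B"
  obtains w where "fst ` set w \<subseteq> B" "reduced_word w" "word_value G w = x"
proof -
  obtain w where w: "fst ` set w \<subseteq> B" "word_value G w = x"
    using assms by (auto simp: generate_eq_word_values)
  have "fst ` set (free_reduction w) \<subseteq> B"
    using w set_free_reduction [of w] by auto
  moreover have "word_value G (free_reduction w) = x"
    using w assms by (simp add: word_value_free_reduction)
  ultimately show thesis
    using that reduced_free_reduction by blast
qed

text \<open>A common first letter cancels. Otherwise \<open>inverse_word u @ v\<close> is itself
  reduced, nonempty and of value one, against freeness.\<close>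

lemma free_set_reduced_word_unique:
  assumes "free_set B"
    and "fst ` set u \<subseteq> B" "reduced_word u" "fst ` set v \<subseteq> B" "reduced_word v"
    and "word_value G u = word_value G v"
  shows "u = v"
  using assms(2-)
proof (induction u arbitrary: v)
  case Nil
  then show ?case using assms(1) by (metis free_set_def word_value_Nil)
next
  case (Cons l u)
  have B: "B \<subseteq> carrier G" using assms(1) by (simp add: free_set_def)
  show ?case
  proof (cases "v \<noteq> [] \<and> hd v = l")
    case True
    then obtain v' where v: "v = l # v'" by (cases v) auto
    have "u = v'"
    proof (rule Cons.IH)
      have "fst l \<in> carrier G" "fst ` set u \<subseteq> carrier G" "fst ` set v' \<subseteq> carrier G"
        using Cons.prems B v by auto
      then show "word_value G u = word_value G v'"
        using Cons.prems v by simp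
    qed (use Cons.prems v in \<open>auto simp: reduced_Cons\<close>)
    then show ?thesis using v by simp
  next
    case False
    let ?w = "inverse_word (l # u) @ v"
    have "reduced_word ?w"
      using Cons.prems False by (auto simp: reduced_append last_inverse_word)
    moreover have "fst ` set ?w \<subseteq> B"
      using Cons.prems by (simp only: set_append image_Un fst_set_inverse_word) simp
    moreover have "word_value G ?w = \<one>"
    proof -
      have c: "fst ` set (l # u) \<subseteq> carrier G" "fst ` set v \<subseteq> carrier G" "fst ` set (inverse_word (l # u)) \<subseteq> carrier G"
        using Cons.prems B by (auto simp del: set_simps simp only: fst_set_inverse_word)
      then have "word_value G ?w = inv (word_value G (l # u)) \<otimes> word_value G v"
        by (simp only: word_value_append word_value_inverse_word)
      then show ?thesis using Cons.prems c by (metis l_inv word_value_closed)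
    qed
    ultimately show ?thesis using assms(1) unfolding free_set_def by (metis append_is_Nil_conv inverse_word_Nil_iff list.distinct(1))
  qed
qed

text \<open>The only reduced word over \<open>B\<close> with value \<open>b\<close> is the single
  letter \<open>b\<close>, so a reduced word for it over \<open>C\<close> must be that
  letter.\<close>

lemma free_set_incl_generate:
  assumes B: "free_set B" "C \<subseteq> B" and b: "b \<in> B" "b \<in> generate G C"
  shows "b \<in> C"
proof -
  have Bc: "B \<subseteq> carrier G" using B by (simp add: free_set_def)
  obtain w where w: "fst ` set w \<subseteq> C" "reduced_word w" "word_value G w = b"
    using generate_reduced_wordE [OF _ b(2)] B(2) Bc by (metis subset_trans)
  have "w = [(b, True)]"
    using w B b Bc by (intro free_set_reduced_word_unique [OF B(1)]) auto
  then show ?thesis using w by simp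
qed

lemma word_value_hom:
  assumes "\<psi> \<in> hom G G" "fst ` set w \<subseteq> carrier G"
  shows "word_value G (map (map_prod \<psi> id) w) = \<psi> (word_value G w)"
proof -
  interpret \<psi>: group_hom G G \<psi>
    using assms(1) by (simp add: group_hom_def group_hom_axioms_def is_group)
  show ?thesis
    using assms(2) by (induction w) (auto simp: letter_value_def)
qed

end

section \<open>Convex sets in the Cayley tree\<close>

locale free_group = group G for G (structure) +
  fixes S :: "'a set"
  assumes basis: "free_basis G S"
begin

lemma free_set_basis: "free_set S"
  and generate_basis: "generate G S = carrier G"
  and basis_subset: "S \<subseteq> carrier G"
  using basis by (auto simp: free_basis_iff free_set_def)

lemma letters_closed: "fst ` set w \<subseteq> S \<Longrightarrow> fst ` set w \<subseteq> carrier G"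
  using basis_subset by blast

lemma letter_closed [simp]: "fst l \<in> S \<Longrightarrow> letter_value l \<in> carrier G"
  using basis_subset by auto

text \<open>Reading \<open>nf (inv x \<otimes> y)\<close> from \<open>x\<close> traces the geodesic
  from \<open>x\<close> to \<open>y\<close> in the Cayley tree; the geometry of the tree is
  expressed through these words.\<close>

definition nf :: "'a \<Rightarrow> ('a \<times> bool) list" where
  "nf x = (SOME w. fst ` set w \<subseteq> S \<and> reduced_word w \<and> word_value G w = x)"

lemma nf_props:
  assumes "x \<in> carrier G"
  shows "fst ` set (nf x) \<subseteq> S \<and> reduced_word (nf x) \<and> word_value G (nf x) = x"
proof -
  have "x \<in> generate G S" using assms generate_basis by simp
  then obtain w where "fst ` set w \<subseteq> S" "reduced_word w" "word_value G w = x"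
    using generate_reduced_wordE [OF basis_subset] by metis
  then have "\<exists>w. fst ` set w \<subseteq> S \<and> reduced_word w \<and> word_value G w = x" by blast
  then show ?thesis unfolding nf_def by (rule someI_ex)
qed

lemma nf_letters: "x \<in> carrier G \<Longrightarrow> fst ` set (nf x) \<subseteq> S"
  and nf_reduced [simp]: "x \<in> carrier G \<Longrightarrow> reduced_word (nf x)"
  and word_value_nf [simp]: "x \<in> carrier G \<Longrightarrow> word_value G (nf x) = x"
  using nf_props by auto

lemma nf_eqI:
  assumes "fst ` set w \<subseteq> S" "reduced_word w" "word_value G w = x"
  shows "nf x = w"
proof -
  have "x \<in> carrier G" using assms letters_closed [of w] word_value_closed [of w] by simp
  then show ?thesis
    using assms free_set_basis nf_letters by (intro free_set_reduced_word_unique [of S]) auto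
qed

lemma nf_one [simp]: "nf \<one> = []"
  by (rule nf_eqI) auto

lemma nf_Nil_iff [simp]: "x \<in> carrier G \<Longrightarrow> nf x = [] \<longleftrightarrow> x = \<one>"
  by (metis nf_one word_value_Nil word_value_nf)

lemma nf_inv: "x \<in> carrier G \<Longrightarrow> nf (inv x) = inverse_word (nf x)"
  using nf_letters [of x] letters_closed [OF nf_letters, of x]
  by (intro nf_eqI) (simp_all only: fst_set_inverse_word reduced_inverse_word word_value_inverse_word nf_reduced word_value_nf)

lemma nf_letter: "fst l \<in> S \<Longrightarrow> nf (letter_value l) = [l]"
  using basis_subset by (intro nf_eqI) auto

lemma fst_hd_nf: "x \<in> carrier G \<Longrightarrow> x \<noteq> \<one> \<Longrightarrow> fst (hd (nf x)) \<in> S"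
  using nf_letters [of x] by (auto simp: image_subset_iff)

lemma inv_mult_eq_one_iff: "x \<in> carrier G \<Longrightarrow> y \<in> carrier G \<Longrightarrow> inv x \<otimes> y = \<one> \<longleftrightarrow> x = y"
  using mult_inv_cancel [of x y] by (metis l_inv r_one)

lemma nf_shift:
  assumes "x \<in> carrier G" "x \<noteq> \<one>"
  shows "nf (inv (letter_value (hd (nf x))) \<otimes> x) = tl (nf x)"
proof (rule nf_eqI)
  have ne: "nf x \<noteq> []" using assms by simp
  then have eq: "nf x = hd (nf x) # tl (nf x)" by simp
  have S: "fst ` set (hd (nf x) # tl (nf x)) \<subseteq> S" using nf_letters [of x] assms eq by simp
  then show "fst ` set (tl (nf x)) \<subseteq> S" by simp
  show "reduced_word (tl (nf x))"
    using nf_reduced [OF assms(1)] eq by (metis reduced_Cons reduced_Nil)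
  have "x = letter_value (hd (nf x)) \<otimes> word_value G (tl (nf x))"
    using word_value_nf [OF assms(1)] eq by (metis word_value_Cons)
  moreover have "letter_value (hd (nf x)) \<in> carrier G" "word_value G (tl (nf x)) \<in> carrier G"
    using S letters_closed basis_subset by auto
  ultimately show "word_value G (tl (nf x)) = inv (letter_value (hd (nf x))) \<otimes> x"
    by (metis inv_mult_cancel)
qed

text \<open>The vertex set of a subtree: the neighbour of \<open>x\<close> on the geodesic to
  \<open>y\<close> stays in \<open>Q\<close>, and iteration gives the whole geodesic. Asking for the
  first step only avoids quantifying over paths.\<close>

definition convex :: "'a set \<Rightarrow> bool" where
  "convex Q \<longleftrightarrow> Q \<subseteq> carrier G \<and>
     (\<forall>x\<in>Q. \<forall>y\<in>Q. x \<noteq> y \<longrightarrow> x \<otimes> letter_value (hd (nf (inv x \<otimes> y))) \<in> Q)"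

lemma convex_subset: "convex Q \<Longrightarrow> Q \<subseteq> carrier G"
  by (simp add: convex_def)

lemma convex_hd:
  "convex Q \<Longrightarrow> x \<in> Q \<Longrightarrow> y \<in> Q \<Longrightarrow> x \<noteq> y \<Longrightarrow> x \<otimes> letter_value (hd (nf (inv x \<otimes> y))) \<in> Q"
  by (simp add: convex_def)

text \<open>This is the first-step condition for the geodesic read backwards from
  \<open>y\<close>.\<close>

lemma convex_last:
  assumes "convex Q" "x \<in> Q" "y \<in> Q" "x \<noteq> y"
  shows "y \<otimes> letter_value (flip (last (nf (inv x \<otimes> y)))) \<in> Q"
proof -
  have c: "x \<in> carrier G" "y \<in> carrier G" using assms convex_subset by auto
  then have "inv x \<otimes> y \<noteq> \<one>" using assms by (simp add: inv_mult_eq_one_iff)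
  then have "hd (nf (inv (inv x \<otimes> y))) = flip (last (nf (inv x \<otimes> y)))"
    using c by (simp add: nf_inv hd_inverse_word)
  moreover have "inv (inv x \<otimes> y) = inv y \<otimes> x" using c by (simp add: group_word_simps)
  ultimately show ?thesis using convex_hd [OF assms(1,3,2)] assms(4) by simp
qed

lemma convex_empty [simp]: "convex {}"
  and convex_single [simp]: "x \<in> carrier G \<Longrightarrow> convex {x}"
  by (auto simp: convex_def)

lemma convex_translate:
  assumes "convex Q" "g \<in> carrier G"
  shows "convex ((\<otimes>) g ` Q)"
proof -
  have "g \<otimes> x \<otimes> letter_value (hd (nf (inv (g \<otimes> x) \<otimes> (g \<otimes> y)))) \<in> (\<otimes>) g ` Q"
    if "x \<in> Q" "y \<in> Q" "x \<noteq> y" for x y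
  proof -
    have c: "x \<in> carrier G" "y \<in> carrier G" using that assms convex_subset by auto
    have "inv (g \<otimes> x) \<otimes> (g \<otimes> y) = inv x \<otimes> y"
      using c assms by (simp add: group_word_simps)
    moreover have "inv x \<otimes> y \<noteq> \<one>" using that c by (simp add: inv_mult_eq_one_iff)
    then have "letter_value (hd (nf (inv x \<otimes> y))) \<in> carrier G"
      using c fst_hd_nf by simp
    ultimately show ?thesis
      using convex_hd [OF assms(1) that] c assms by (simp add: m_assoc)
  qed
  then show ?thesis
    using assms convex_subset [OF assms(1)] by (auto simp: convex_def)
qed

lemma convex_Union_chain:
  assumes "\<And>Q. Q \<in> \<C> \<Longrightarrow> convex Q" "\<And>Q Q'. Q \<in> \<C> \<Longrightarrow> Q' \<in> \<C> \<Longrightarrow> Q \<subseteq> Q' \<or> Q' \<subseteq> Q"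
  shows "convex (\<Union>\<C>)"
proof -
  have "x \<otimes> letter_value (hd (nf (inv x \<otimes> y))) \<in> \<Union>\<C>"
    if xy: "x \<in> Q" "Q \<in> \<C>" "y \<in> Q'" "Q' \<in> \<C>" "x \<noteq> y" for x y Q Q'
  proof -
    obtain Q'' where "Q'' \<in> \<C>" "x \<in> Q''" "y \<in> Q''"
      using assms(2) [OF xy(2,4)] xy by blast
    then show ?thesis using convex_hd [OF assms(1)] xy(5) by blast
  qed
  moreover have "\<Union>\<C> \<subseteq> carrier G" using assms(1) convex_subset by auto
  ultimately show ?thesis unfolding convex_def by auto
qed

text \<open>Every path between the two subtrees uses the joining edge. The concatenation is reduced
  since a cancellation against \<open>a\<close> would place
  \<open>q \<otimes> letter_value a\<close> in \<open>Q\<close> or \<open>q\<close> in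
  \<open>Q'\<close>.\<close>

lemma nf_inv_mult_crossing:
  assumes Q: "convex Q" "convex Q'" "Q \<inter> Q' = {}"
    and q: "q \<in> Q" "fst a \<in> S" "q \<otimes> letter_value a \<in> Q'" and x: "x \<in> Q" and y: "y \<in> Q'"
  shows "nf (inv x \<otimes> y) = nf (inv x \<otimes> q) @ a # nf (inv (q \<otimes> letter_value a) \<otimes> y)"
proof -
  let ?z = "q \<otimes> letter_value a"
  let ?u = "nf (inv x \<otimes> q)" and ?v = "nf (inv ?z \<otimes> y)"
  have c: "q \<in> carrier G" "x \<in> carrier G" "y \<in> carrier G" "letter_value a \<in> carrier G"
    using assms convex_subset by auto
  have a: "flip (flip a) = a" "letter_value (flip a) = inv (letter_value a)"
    using q basis_subset by (auto simp: letter_value_flip)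
  have u: "last ?u \<noteq> flip a" if "?u \<noteq> []"
  proof
    assume "last ?u = flip a"
    moreover have "x \<noteq> q" using that c by auto
    ultimately have "?z \<in> Q"
      using convex_last [OF Q(1) x q(1)] by simp
    then show False using Q q by blast
  qed
  have v: "hd ?v \<noteq> flip a" if "?v \<noteq> []"
  proof
    assume "hd ?v = flip a"
    moreover have "y \<noteq> ?z" using that c by auto
    ultimately have "?z \<otimes> letter_value (flip a) \<in> Q'"
      using convex_hd [OF Q(2) q(3) y] by auto
    then have "q \<in> Q'" using c a by (simp add: m_assoc)
    then show False using Q q by blast
  qed
  show ?thesis
  proof (rule nf_eqI)
    show "fst ` set (?u @ a # ?v) \<subseteq> S"
      using nf_letters [of "inv x \<otimes> q"] nf_letters [of "inv ?z \<otimes> y"] c q by auto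
    then have "fst ` set ?u \<subseteq> carrier G" "fst ` set (a # ?v) \<subseteq> carrier G"
      by (metis letters_closed set_append image_Un le_sup_iff)+
    then show "word_value G (?u @ a # ?v) = inv x \<otimes> y"
      using c by (simp add: word_value_append group_word_simps)
    show "reduced_word (?u @ a # ?v)"
      using u v c by (auto simp: reduced_append reduced_Cons)
  qed
qed

lemma convex_Un_step:
  assumes Q: "convex Q" "convex Q'" "Q \<inter> Q' = {}"
    and q: "q \<in> Q" "fst a \<in> S" "q \<otimes> letter_value a \<in> Q'" and x: "x \<in> Q" and y: "y \<in> Q'"
  shows "x \<otimes> letter_value (hd (nf (inv x \<otimes> y))) \<in> Q \<union> Q'"
proof (cases "x = q")
  case True
  then have "hd (nf (inv x \<otimes> y)) = a"
    using nf_inv_mult_crossing [OF assms] convex_subset [OF Q(1)] x by auto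
  then show ?thesis using True q by simp
next
  case False
  then have "nf (inv x \<otimes> q) \<noteq> []"
    using convex_subset [OF Q(1)] x q by (metis False inv_closed inv_mult_eq_one_iff m_closed nf_Nil_iff subset_iff)
  then have "hd (nf (inv x \<otimes> y)) = hd (nf (inv x \<otimes> q))"
    using nf_inv_mult_crossing [OF assms] by simp
  then show ?thesis using convex_hd [OF Q(1) x q(1) False] by simp
qed

lemma convex_Un:
  assumes Q: "convex Q" "convex Q'" "Q \<inter> Q' = {}"
    and q: "q \<in> Q" "fst a \<in> S" "q \<otimes> letter_value a \<in> Q'"
  shows "convex (Q \<union> Q')"
proof -
  have c: "q \<in> carrier G" "letter_value a \<in> carrier G" using assms convex_subset by auto
  have q': "q \<otimes> letter_value a \<otimes> letter_value (flip a) \<in> Q"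
    using q c basis_subset by (auto simp: letter_value_flip m_assoc)
  show ?thesis
    unfolding convex_def
  proof (intro conjI ballI impI)
    show "Q \<union> Q' \<subseteq> carrier G" using Q convex_subset by auto
    fix x y assume xy: "x \<in> Q \<union> Q'" "y \<in> Q \<union> Q'" "x \<noteq> y"
    show "x \<otimes> letter_value (hd (nf (inv x \<otimes> y))) \<in> Q \<union> Q'"
      using xy convex_hd [OF Q(1), of x y] convex_hd [OF Q(2), of x y]
        convex_Un_step [OF Q q, of x y] convex_Un_step [OF Q(2,1) _ q(3) _ q', of x y] Q(3) q(2)
      by (auto simp: Int_commute)
  qed
qed

text \<open>The geodesic from \<open>q\<close> to \<open>u\<close> stays in \<open>R\<close>; its
  vertices are added one at a time, each adjacent to the set already built. The induction runs over
  the length still to be walked.\<close>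

lemma convex_finite_superset_insert:
  assumes "convex R" "Q \<subseteq> R" "finite Q" "convex Q" "q \<in> Q" "u \<in> R"
  shows "\<exists>Q'. finite Q' \<and> convex Q' \<and> Q \<subseteq> Q' \<and> u \<in> Q' \<and> Q' \<subseteq> R"
  using assms(2-6)
proof (induction "length (nf (inv q \<otimes> u))" arbitrary: q Q rule: less_induct)
  case less
  have c: "q \<in> carrier G" "u \<in> carrier G" using less.prems assms(1) convex_subset by auto
  show ?case
  proof (cases "q = u")
    case True
    then show ?thesis using less.prems by blast
  next
    case False
    let ?a = "hd (nf (inv q \<otimes> u))"
    let ?r = "q \<otimes> letter_value ?a"
    have ne: "inv q \<otimes> u \<noteq> \<one>" using c False by (simp add: inv_mult_eq_one_iff)
    then have a: "fst ?a \<in> S" using c fst_hd_nf by simp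
    have r: "?r \<in> R" using convex_hd [OF assms(1)] less.prems False by blast
    have "nf (inv ?r \<otimes> u) = tl (nf (inv q \<otimes> u))"
      using nf_shift [of "inv q \<otimes> u"] c a ne by (simp add: group_word_simps)
    then have len: "length (nf (inv ?r \<otimes> u)) < length (nf (inv q \<otimes> u))"
      using ne c by simp
    have conv: "convex (insert ?r Q)"
    proof (cases "?r \<in> Q")
      case True
      then show ?thesis using less.prems by (simp add: insert_absorb)
    next
      case False
      then have "convex (Q \<union> {?r})"
        using less.prems a c by (intro convex_Un [of Q "{?r}" q ?a]) auto
      then show ?thesis by simp
    qed
    have "\<exists>Q'. finite Q' \<and> convex Q' \<and> insert ?r Q \<subseteq> Q' \<and> u \<in> Q' \<and> Q' \<subseteq> R"
      using less.prems r conv by (intro less.hyps [OF len]) auto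
    then show ?thesis by blast
  qed
qed

lemma convex_finite_superset:
  assumes "convex R" "q \<in> R" "finite U" "U \<subseteq> R"
  shows "\<exists>Q. finite Q \<and> convex Q \<and> q \<in> Q \<and> U \<subseteq> Q \<and> Q \<subseteq> R"
  using assms(3,4)
proof (induction U)
  case empty
  then show ?case using assms convex_subset [of R] by (intro exI [of _ "{q}"]) auto
next
  case (insert u U)
  then obtain Q where "finite Q" "convex Q" "q \<in> Q" "U \<subseteq> Q" "Q \<subseteq> R" by auto
  then show ?case
    using convex_finite_superset_insert [OF assms(1), of Q q u] insert.prems
    by (metis insert_subset subset_eq)
qed

end

section \<open>Schreier generators\<close>

context group
begin

text \<open>Right cosets: the edges of the Cayley tree join \<open>x\<close> to
  \<open>x \<otimes> s\<close>, and \<open>H\<close> acts on it by left multiplication, so right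
  cosets are the vertices of the quotient, the Schreier graph.\<close>

definition same_coset :: "'a set \<Rightarrow> 'a \<Rightarrow> 'a \<Rightarrow> bool" where
  "same_coset H x y \<longleftrightarrow> x \<otimes> inv y \<in> H"

lemma same_coset_sym:
  assumes "subgroup H G" "x \<in> carrier G" "y \<in> carrier G" "same_coset H x y"
  shows "same_coset H y x"
proof -
  have "inv (x \<otimes> inv y) \<in> H"
    using assms by (simp add: same_coset_def subgroup.m_inv_closed)
  then show ?thesis using assms by (simp add: same_coset_def group_word_simps)
qed

lemma same_coset_trans:
  assumes "subgroup H G" "x \<in> carrier G" "y \<in> carrier G" "z \<in> carrier G"
    and "same_coset H x y" "same_coset H y z"
  shows "same_coset H x z"
proof -
  have "(x \<otimes> inv y) \<otimes> (y \<otimes> inv z) \<in> H"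
    using assms by (simp add: same_coset_def subgroup.m_closed)
  then show ?thesis using assms by (simp add: same_coset_def group_word_simps)
qed

lemma same_coset_iff_r_coset:
  assumes "subgroup H G" "x \<in> carrier G" "y \<in> carrier G"
  shows "same_coset H x y \<longleftrightarrow> H #> x = H #> y"
proof -
  have *: "H #> z = {w \<in> carrier G. same_coset H w z}" if "z \<in> carrier G" for z
  proof (intro equalityI subsetI)
    fix w assume "w \<in> H #> z"
    then show "w \<in> {w \<in> carrier G. same_coset H w z}"
      using that assms(1) subgroup.mem_carrier [OF assms(1)]
      by (auto simp: r_coset_def same_coset_def m_assoc)
  next
    fix w assume "w \<in> {w \<in> carrier G. same_coset H w z}"
    then have "w \<otimes> inv z \<in> H" "w = w \<otimes> inv z \<otimes> z"
      using that by (auto simp: same_coset_def m_assoc)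
    then show "w \<in> H #> z" unfolding r_coset_def by blast
  qed
  have refl: "same_coset H x x"
    using assms by (simp add: same_coset_def subgroup.one_closed)
  show ?thesis
  proof
    assume "H #> x = H #> y"
    then show "same_coset H x y" using refl assms by (auto simp: *)
  next
    assume xy: "same_coset H x y"
    show "H #> x = H #> y"
      using assms xy same_coset_sym [OF assms xy]
        same_coset_trans [OF assms(1) _ assms(2,3)] same_coset_trans [OF assms(1) _ assms(3,2)]
      by (auto simp: *)
  qed
qed

lemma same_coset_refl [simp]: "subgroup H G \<Longrightarrow> x \<in> carrier G \<Longrightarrow> same_coset H x x"
  by (simp add: same_coset_def subgroup.one_closed)

lemma same_coset_mult_right:
  "x \<in> carrier G \<Longrightarrow> y \<in> carrier G \<Longrightarrow> a \<in> carrier G \<Longrightarrow>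
     same_coset H (x \<otimes> a) (y \<otimes> a) \<longleftrightarrow> same_coset H x y"
  by (simp add: same_coset_def group_word_simps)

lemma same_coset_mult_left:
  assumes "subgroup H G" "h \<in> H" "x \<in> carrier G"
  shows "same_coset H (h \<otimes> x) x"
  using assms subgroup.subset by (force simp: same_coset_def group_word_simps)

end

text \<open>A Schreier transversal: \<open>Q\<close> lifts a spanning tree of the Schreier graph of
  \<open>H\<close> to the Cayley tree, and the translates of \<open>Q\<close> by \<open>H\<close>
  partition the vertices.\<close>

locale schreier_domain = free_group +
  fixes H Q :: "'a set"
  assumes subgroup_H: "subgroup H G"
    and convex_Q: "convex Q"
    and one_Q: "\<one> \<in> Q"
    and coset_unique: "q \<in> Q \<Longrightarrow> q' \<in> Q \<Longrightarrow> same_coset H q q' \<Longrightarrow> q = q'"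
    and coset_exists: "x \<in> carrier G \<Longrightarrow> \<exists>q\<in>Q. same_coset H x q"
begin

lemma H_closed: "H \<subseteq> carrier G" and Q_closed: "Q \<subseteq> carrier G"
  using subgroup_H convex_Q convex_subset by (auto simp: subgroup.subset)

definition rep :: "'a \<Rightarrow> 'a" where
  "rep x = (SOME q. q \<in> Q \<and> same_coset H x q)"

lemma rep: "x \<in> carrier G \<Longrightarrow> rep x \<in> Q \<and> same_coset H x (rep x)"
  unfolding rep_def by (rule someI_ex) (use coset_exists [of x] in blast)

lemma rep_in_Q [simp]: "x \<in> carrier G \<Longrightarrow> rep x \<in> Q"
  and rep_closed [simp]: "x \<in> carrier G \<Longrightarrow> rep x \<in> carrier G"
  and same_coset_rep: "x \<in> carrier G \<Longrightarrow> same_coset H x (rep x)"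
  using rep Q_closed by auto

lemma rep_eqI:
  assumes "x \<in> carrier G" "q \<in> Q" "same_coset H x q"
  shows "rep x = q"
proof -
  have "same_coset H (rep x) q"
    using assms Q_closed same_coset_rep [of x] subgroup_H
    by (meson rep_closed same_coset_sym same_coset_trans subsetD)
  then show ?thesis using assms coset_unique by simp
qed

lemma rep_eq_iff:
  assumes "x \<in> carrier G" "y \<in> carrier G"
  shows "rep x = rep y \<longleftrightarrow> same_coset H x y"
proof
  assume "rep x = rep y"
  then show "same_coset H x y"
    using assms same_coset_rep subgroup_H by (metis rep_closed same_coset_sym same_coset_trans)
next
  assume "same_coset H x y"
  then show "rep x = rep y"
    using assms same_coset_rep [of y] subgroup_H
    by (intro rep_eqI) (auto intro: same_coset_trans [of H x y])
qed

text \<open>These are the edges outside the spanning tree, in positive orientation only. If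
  \<open>q \<otimes> s\<close> lies in \<open>Q\<close>, the associated Schreier generator is one,
  so such an edge cannot contribute to a free family.\<close>

definition leaving_edges :: "('a \<times> 'a) set" where
  "leaving_edges = {(q, s). q \<in> Q \<and> s \<in> S \<and> q \<otimes> s \<notin> Q}"

definition gen :: "'a \<times> 'a \<Rightarrow> 'a" where
  "gen e = fst e \<otimes> snd e \<otimes> inv (rep (fst e \<otimes> snd e))"

text \<open>A word in the leaving edges is traced as a path in the Cayley tree through the translates of
  \<open>Q\<close>; a letter crosses from the vertex \<open>departure l\<close> of a translate along \<open>label l\<close> and arrives
  at the vertex \<open>departure (flip l)\<close> of the next one.\<close>

definition departure :: "('a \<times> 'a) \<times> bool \<Rightarrow> 'a" where
  "departure l = (if snd l then fst (fst l) else rep (fst (fst l) \<otimes> snd (fst l)))"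

definition label :: "('a \<times> 'a) \<times> bool \<Rightarrow> 'a \<times> bool" where
  "label l = (snd (fst l), snd l)"

lemma leaving_edge:
  assumes "e \<in> leaving_edges"
  shows "fst e \<in> Q" "snd e \<in> S" "fst e \<otimes> snd e \<notin> Q" "fst e \<in> carrier G" "snd e \<in> carrier G"
  using assms Q_closed basis_subset by (auto simp: leaving_edges_def)

lemma gen_in_H: "e \<in> leaving_edges \<Longrightarrow> gen e \<in> H"
  using same_coset_rep leaving_edge by (simp add: gen_def same_coset_def)

lemma gen_closed [simp]: "e \<in> leaving_edges \<Longrightarrow> gen e \<in> carrier G"
  using gen_in_H H_closed by blast

lemma label_flip [simp]: "label (flip l) = flip (label l)"
  and fst_label [simp]: "fst (label l) = snd (fst l)"
  by (auto simp: label_def flip_def)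

lemma label_value_closed [simp]: "fst l \<in> leaving_edges \<Longrightarrow> letter_value (label l) \<in> carrier G"
  using leaving_edge by simp

lemma departure_in_Q [simp]: "fst l \<in> leaving_edges \<Longrightarrow> departure l \<in> Q"
  using leaving_edge by (auto simp: departure_def)

lemma departure_closed [simp]: "fst l \<in> leaving_edges \<Longrightarrow> departure l \<in> carrier G"
  using departure_in_Q Q_closed by blast

text \<open>For an inverted edge, \<open>rep (q \<otimes> s) \<otimes> inv s\<close> lies in the
  coset of \<open>q\<close>. Were it in \<open>Q\<close>, it would be \<open>q\<close>, and the edge
  would not leave \<open>Q\<close>.\<close>

lemma departure_leaves:
  assumes "fst l \<in> leaving_edges"
  shows "departure l \<otimes> letter_value (label l) \<notin> Q"
proof (cases "snd l")
  case True
  then show ?thesis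
    using leaving_edge(3) [OF assms] by (simp add: departure_def label_def letter_value_def)
next
  case False
  obtain q s where qs: "fst l = (q, s)" by fastforce
  have q: "q \<in> Q" "s \<in> S" "q \<otimes> s \<notin> Q" "q \<in> carrier G" "s \<in> carrier G"
    using leaving_edge [OF assms] qs by auto
  show ?thesis
  proof
    assume "departure l \<otimes> letter_value (label l) \<in> Q"
    then have *: "rep (q \<otimes> s) \<otimes> inv s \<in> Q"
      using False qs by (simp add: departure_def label_def letter_value_def)
    have "same_coset H (q \<otimes> s \<otimes> inv s) (rep (q \<otimes> s) \<otimes> inv s)"
      using q same_coset_rep [of "q \<otimes> s"] by (subst same_coset_mult_right) auto
    then have "q = rep (q \<otimes> s) \<otimes> inv s"
      using coset_unique [OF q(1) *] q by (simp add: m_assoc)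
    then have "q \<otimes> s = rep (q \<otimes> s)"
      using q by (metis inv_solve_right m_closed rep_closed)
    then show False using q by (metis m_closed rep_in_Q)
  qed
qed

text \<open>The edge that starts in \<open>Q\<close> ends in the translate of \<open>Q\<close> by
  the signed generator; seen from that translate, its endpoint is
  \<open>departure (flip l)\<close>.\<close>

lemma crossing:
  assumes "fst l \<in> leaving_edges"
  shows "letter_value (gen (fst l), snd l) \<otimes> departure (flip l) = departure l \<otimes> letter_value (label l)"
  using leaving_edge [OF assms]
  by (auto simp: gen_def departure_def label_def letter_value_def group_word_simps)

lemma departure_label_inj:
  assumes l: "fst l \<in> leaving_edges" and m: "fst m \<in> leaving_edges"
    and eq: "departure l = departure m" "label l = label m"
  shows "l = m"
proof -
  obtain q s b q' where lm: "l = ((q, s), b)" "m = ((q', s), b)"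
    using eq(2) unfolding label_def by (metis Pair_inject prod.collapse)
  have q: "q \<in> Q" "q' \<in> Q" "q \<in> carrier G" "q' \<in> carrier G" "s \<in> carrier G"
    using leaving_edge [OF l] leaving_edge [OF m] lm by auto
  have "q = q'"
  proof (cases b)
    case True
    then show ?thesis using eq lm by (simp add: departure_def)
  next
    case False
    then have "rep (q \<otimes> s) = rep (q' \<otimes> s)" using eq lm by (simp add: departure_def)
    then have "same_coset H q q'" using q by (simp add: rep_eq_iff same_coset_mult_right)
    then show ?thesis using coset_unique q by blast
  qed
  then show ?thesis using lm by simp
qed

lemma exists_departure:
  assumes q: "q \<in> Q" and l: "fst l \<in> S" and leaves: "q \<otimes> letter_value l \<notin> Q"
  shows "\<exists>m. fst m \<in> leaving_edges \<and> departure m = q \<and> label m = l"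
proof -
  let ?s = "fst l"
  have c: "q \<in> carrier G" "?s \<in> carrier G" "letter_value l \<in> carrier G"
    using q l Q_closed basis_subset by auto
  show ?thesis
  proof (cases "snd l")
    case True
    then have "(q, ?s) \<in> leaving_edges"
      using leaves q l by (simp add: leaving_edges_def letter_value_def)
    then show ?thesis
      using True by (intro exI [of _ "((q, ?s), True)"]) (auto simp: departure_def label_def prod_eq_iff)
  next
    case ls: False
    let ?p = "rep (q \<otimes> inv ?s)"
    have lv: "letter_value l = inv ?s" using ls by (simp add: letter_value_def)
    have p: "?p \<in> Q" "?p \<in> carrier G" using c by auto
    have "same_coset H (q \<otimes> inv ?s \<otimes> ?s) (?p \<otimes> ?s)"
      using c p same_coset_rep [of "q \<otimes> inv ?s"] by (subst same_coset_mult_right) auto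
    then have sc: "same_coset H q (?p \<otimes> ?s)" using c p by (simp add: m_assoc)
    then have q_sc: "same_coset H (?p \<otimes> ?s) q"
      using same_coset_sym [OF subgroup_H _ _ sc] c p by simp
    then have rep_q: "rep (?p \<otimes> ?s) = q"
      using c p rep_eqI [OF _ q] by simp
    have "?p \<otimes> ?s \<notin> Q"
    proof
      assume "?p \<otimes> ?s \<in> Q"
      then have "?p \<otimes> ?s = q" using coset_unique q q_sc by blast
      then have "?p = q \<otimes> inv ?s" using c p by (metis inv_solve_right)
      then show False using leaves lv p by simp
    qed
    then have "(?p, ?s) \<in> leaving_edges" using p l by (simp add: leaving_edges_def)
    then show ?thesis
      using ls rep_q
      by (intro exI [of _ "((?p, ?s), False)"]) (auto simp: departure_def label_def prod_eq_iff)
  qed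
qed

abbreviation gen_word :: "(('a \<times> 'a) \<times> bool) list \<Rightarrow> ('a \<times> bool) list" where
  "gen_word w \<equiv> map (map_prod gen id) w"

lemma gen_word_closed: "fst ` set w \<subseteq> leaving_edges \<Longrightarrow> fst ` set (gen_word w) \<subseteq> carrier G"
  by auto

text \<open>After a crossing the path stands at \<open>departure (flip l)\<close>, where going
  straight back would leave \<open>Q\<close>. A walk inside \<open>Q\<close> therefore cannot begin
  with the inverse of the label.\<close>

lemma reduced_snoc_nf:
  assumes "reduced_word (t @ [label l])" "fst l \<in> leaving_edges" "y \<in> Q"
  shows "reduced_word (t @ [label l] @ nf (inv (departure (flip l)) \<otimes> y))"
proof -
  have c: "departure (flip l) \<in> Q" "departure (flip l) \<in> carrier G" "y \<in> carrier G"
    using assms Q_closed by auto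
  have "hd (nf (inv (departure (flip l)) \<otimes> y)) \<noteq> flip (label l)"
    if "nf (inv (departure (flip l)) \<otimes> y) \<noteq> []"
  proof
    assume hd: "hd (nf (inv (departure (flip l)) \<otimes> y)) = flip (label l)"
    have "departure (flip l) \<noteq> y" using that c by auto
    then have "departure (flip l) \<otimes> letter_value (label (flip l)) \<in> Q"
      using convex_hd [OF convex_Q c(1) assms(3)] hd by simp
    then show False using departure_leaves [of "flip l"] assms by simp
  qed
  then show ?thesis using assms c by (auto simp: reduced_append reduced_Cons)
qed

lemma last_nf_departure:
  assumes "fst l \<in> leaving_edges" "x \<in> Q" "x \<noteq> departure l"
  shows "last (nf (inv x \<otimes> departure l)) \<noteq> flip (label l)"
proof
  assume "last (nf (inv x \<otimes> departure l)) = flip (label l)"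
  then have "departure l \<otimes> letter_value (label l) \<in> Q"
    using convex_last [OF convex_Q assms(2) departure_in_Q [OF assms(1)] assms(3)] by simp
  then show False using departure_leaves assms by simp
qed

text \<open>Between consecutive crossings the path walks inside one translate, and it never turns
  back over a crossing edge, because that edge leaves the translate. The final crossing letter is
  kept visible so that the next walk can be attached.\<close>

lemma crossing_path:
  assumes "reduced_word w" "fst ` set w \<subseteq> leaving_edges" "w \<noteq> []"
  shows "\<exists>t. fst ` set t \<subseteq> S \<and> reduced_word (t @ [label (last w)]) \<and>
    word_value G (t @ [label (last w)]) = word_value G (gen_word w) \<otimes> departure (flip (last w))"
  using assms
proof (induction w rule: rev_induct)
  case (snoc l w)
  have l: "fst l \<in> leaving_edges" "label l \<in> S \<times> UNIV" and w: "fst ` set w \<subseteq> leaving_edges"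
    using snoc.prems leaving_edge(2) [of "fst l"] by (auto simp: label_def)
  have gl: "letter_value (gen (fst l), snd l) \<in> carrier G" using l by (simp add: letter_value_def)
  have gw: "word_value G (gen_word w) \<in> carrier G" using gen_word_closed [OF w] by simp
  have val: "word_value G (gen_word (w @ [l])) \<otimes> departure (flip l) =
      word_value G (gen_word w) \<otimes> (departure l \<otimes> letter_value (label l))"
  proof -
    have "word_value G (gen_word (w @ [l])) =
        word_value G (gen_word w) \<otimes> letter_value (gen (fst l), snd l)"
      using gen_word_closed [OF w] l gl
      by (cases l) (auto simp: word_value_append map_prod_def)
    then show ?thesis
      using crossing [OF l(1)] l gl gw by (simp add: m_assoc)
  qed
  show ?case
  proof (cases "w = []")
    case True
    let ?t = "nf (departure l)"
    have t: "fst ` set ?t \<subseteq> S" "reduced_word ?t" using l nf_letters by auto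
    have "reduced_word (?t @ [label l])"
    proof (cases "departure l = \<one>")
      case False
      then have "label l \<noteq> flip (last ?t)"
        using last_nf_departure [OF l(1) one_Q] l by (metis departure_closed flip_flip inv_one l_one)
      then show ?thesis using t by (simp add: reduced_append)
    qed simp
    moreover have "word_value G (?t @ [label l]) = \<one> \<otimes> (departure l \<otimes> letter_value (label l))"
      using t l letters_closed [OF t(1)] leaving_edge(5) [of "fst l"] by (simp add: word_value_append)
    ultimately show ?thesis
      unfolding last_snoc val using True t by (intro exI [of _ ?t]) simp
  next
    case False
    let ?m = "last w"
    have m: "fst ?m \<in> leaving_edges" "fst (flip ?m) \<in> leaving_edges" using False w by auto
    have "reduced_word w" "flip ?m \<noteq> l"
      using snoc.prems False by (auto simp: reduced_append)
    then obtain t where t: "fst ` set t \<subseteq> S" "reduced_word (t @ [label ?m])"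
      "word_value G (t @ [label ?m]) = word_value G (gen_word w) \<otimes> departure (flip ?m)"
      using snoc.IH w False by blast
    let ?y = "inv (departure (flip ?m)) \<otimes> departure l"
    let ?t = "(t @ [label ?m]) @ nf ?y"
    have y: "?y \<in> carrier G" using l m by simp
    have S: "fst ` set ?t \<subseteq> S" "fst ` set (t @ [label ?m]) \<subseteq> S"
      using t l m nf_letters [OF y] leaving_edge(2) [OF m(1)] by auto
    have red: "reduced_word ?t"
      using reduced_snoc_nf [OF t(2) m(1), of "departure l"] l by simp
    have "last ?t \<noteq> flip (label l)"
    \<comment> \<open>If the two crossings touch the same vertex, no walk separates them, and only
      the reducedness of \<open>w\<close> prevents a cancellation.\<close>
    proof (cases "departure (flip ?m) = departure l")
      case True
      have "label ?m \<noteq> flip (label l)"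
        using departure_label_inj [OF m(2) l(1) True] \<open>flip ?m \<noteq> l\<close> by auto
      then show ?thesis using True l by simp
    next
      case False
      then have "nf ?y \<noteq> []" using l m by (subst nf_Nil_iff) (auto simp: inv_mult_eq_one_iff)
      then show ?thesis using last_nf_departure [OF l(1) departure_in_Q [OF m(2)] False] by simp
    qed
    then have "reduced_word (?t @ [label l])"
      using red unfolding reduced_snoc by blast
    moreover have "word_value G (?t @ [label l]) =
        word_value G (gen_word w) \<otimes> (departure l \<otimes> letter_value (label l))"
    proof -
      have "fst ` set ?t \<subseteq> carrier G" "fst ` set (t @ [label ?m]) \<subseteq> carrier G"
          "fst ` set (nf ?y) \<subseteq> carrier G" "fst ` set [label l] \<subseteq> carrier G"
        using letters_closed [OF S(1)] letters_closed [OF S(2)] letters_closed [OF nf_letters [OF y]]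
          leaving_edge(5) [of "fst l"] l by simp_all
      then show ?thesis
        using t l m gw y by (simp only: word_value_append word_value_nf)
          (simp add: group_word_simps)
    qed
    ultimately show ?thesis
      unfolding last_snoc val using S by (intro exI [of _ ?t]) simp
  qed
qed simp

text \<open>If the value were one, the path would end in \<open>Q\<close> itself, and walking on
  inside \<open>Q\<close> to \<one> would close it up to a nonempty reduced word of value
  one.\<close>

lemma gen_word_nontrivial:
  assumes "reduced_word w" "fst ` set w \<subseteq> leaving_edges" "w \<noteq> []"
  shows "word_value G (gen_word w) \<noteq> \<one>"
proof
  assume one: "word_value G (gen_word w) = \<one>"
  let ?l = "last w"
  have l: "fst ?l \<in> leaving_edges" using assms by auto
  obtain t where t: "fst ` set t \<subseteq> S" "reduced_word (t @ [label ?l])"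
    "word_value G (t @ [label ?l]) = departure (flip ?l)"
    using crossing_path [OF assms] one l by auto
  let ?y = "inv (departure (flip ?l)) \<otimes> \<one>"
  let ?t = "(t @ [label ?l]) @ nf ?y"
  have y: "?y \<in> carrier G" using l by simp
  have "reduced_word ?t"
    using reduced_snoc_nf [OF t(2) l one_Q] by simp
  moreover have S: "fst ` set (t @ [label ?l]) \<subseteq> S" "fst ` set (nf ?y) \<subseteq> S"
    using t leaving_edge(2) [OF l] nf_letters [OF y] by auto
  then have "fst ` set ?t \<subseteq> S" by (simp only: set_append image_Un) simp
  moreover have "word_value G ?t = \<one>"
    using t l y letters_closed [OF S(1)] letters_closed [OF S(2)]
    by (simp only: word_value_append word_value_nf) simp
  ultimately show False using free_set_basis unfolding free_set_def by blast
qed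

text \<open>Two edges with the same generator would make a reduced word of length two trivial: one
  edge followed by the inverse of the other.\<close>

lemma inj_on_gen: "inj_on gen leaving_edges"
proof (rule inj_onI, rule ccontr)
  fix e f assume ef: "e \<in> leaving_edges" "f \<in> leaving_edges" "gen e = gen f" "e \<noteq> f"
  have "word_value G (gen_word [(e, True), (f, False)]) \<noteq> \<one>"
    using ef by (intro gen_word_nontrivial) (auto simp: reduced_Cons)
  then show False using ef by simp
qed

lemma free_set_gen: "free_set (gen ` leaving_edges)"
proof -
  have "word_value G w \<noteq> \<one>"
    if w: "w \<noteq> []" "fst ` set w \<subseteq> gen ` leaving_edges" "reduced_word w" for w
  proof -
    let ?i = "inv_into leaving_edges gen"
    let ?v = "map (map_prod ?i id) w"
    have "gen_word ?v = w"
      using w by (auto simp: image_subset_iff f_inv_into_f intro!: map_idI)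
    moreover have "fst ` set ?v \<subseteq> leaving_edges"
      using w by (auto simp: image_subset_iff intro!: inv_into_into)
    moreover have "reduced_word ?v"
    proof -
      have "successively (\<lambda>l m. m \<noteq> flip l) (gen_word ?v)"
        using \<open>gen_word ?v = w\<close> w by (simp add: reduced_word_iff)
      then have "successively (\<lambda>l m. map_prod gen id m \<noteq> flip (map_prod gen id l)) ?v"
        by (subst (asm) successively_map)
      then show ?thesis
        unfolding reduced_word_iff by (rule successively_mono) (auto simp: flip_def)
    qed
    ultimately show ?thesis using gen_word_nontrivial [of ?v] w by auto
  qed
  then show ?thesis by (auto simp: free_set_def)
qed

text \<open>\<open>Q\<close> already meets every right coset of the generated group
  \<open>?K\<close>, since a step along a letter stays in \<open>Q\<close> or crosses at the cost of
  a generator. An element of \<open>H\<close> is then equivalent modulo \<open>?K\<close> to a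
  vertex of \<open>Q\<close> in the coset \<open>H\<close>, and that vertex can only be
  \<one>.\<close>

lemma generate_gen: "generate G (gen ` leaving_edges) = H"
proof
  show "generate G (gen ` leaving_edges) \<subseteq> H"
    using gen_in_H subgroup_H by (intro generate_subgroup_incl) auto
  let ?K = "generate G (gen ` leaving_edges)"
  have K: "subgroup ?K G" by (rule generate_is_subgroup) auto
  have step: "\<exists>q'\<in>Q. same_coset ?K (q \<otimes> letter_value l) q'" if q: "q \<in> Q" and l: "fst l \<in> S" for q l
  proof -
    have c: "q \<in> carrier G" "letter_value l \<in> carrier G"
      using q l Q_closed by auto
    show ?thesis
    proof (cases "q \<otimes> letter_value l \<in> Q")
      case True
      then show ?thesis using K c by (intro bexI [of _ "q \<otimes> letter_value l"]) auto
    next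
      case False
      then obtain m where m: "fst m \<in> leaving_edges" "departure m = q" "label m = l"
        using exists_departure q l by blast
      have "gen (fst m) \<in> ?K" using m by (simp add: generate.incl)
      then have g: "letter_value (gen (fst m), snd m) \<in> ?K" "letter_value (gen (fst m), snd m) \<in> carrier G"
        using K m by (auto simp: letter_value_def subgroup.m_inv_closed)
      have "same_coset ?K (q \<otimes> letter_value l) (departure (flip m))"
        using crossing [OF m(1)] same_coset_mult_left [OF K g(1), of "departure (flip m)"] m by simp
      then show ?thesis using m by (intro bexI [of _ "departure (flip m)"]) auto
    qed
  qed
  have "\<exists>q\<in>Q. same_coset ?K (word_value G w) q" if "fst ` set w \<subseteq> S" for w
    using that
  proof (induction w rule: rev_induct)
    case Nil
    then show ?case using one_Q K by (intro bexI [of _ \<one>]) auto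
  next
    case (snoc l w)
    then obtain q where q: "q \<in> Q" "same_coset ?K (word_value G w) q" by auto
    obtain q' where q': "q' \<in> Q" "same_coset ?K (q \<otimes> letter_value l) q'"
      using step [OF q(1), of l] snoc.prems by auto
    have c: "q \<in> carrier G" "q' \<in> carrier G" "letter_value l \<in> carrier G"
      "fst ` set w \<subseteq> carrier G" "fst l \<in> carrier G" "word_value G w \<in> carrier G"
      using q q' snoc.prems Q_closed basis_subset letters_closed [of w] by auto
    have "same_coset ?K (word_value G w \<otimes> letter_value l) (q \<otimes> letter_value l)"
      using q c by (simp add: same_coset_mult_right)
    then have "same_coset ?K (word_value G w \<otimes> letter_value l) q'"
      using same_coset_trans [OF K _ _ _ _ q'(2)] c by simp
    then show ?case using q' c by (intro bexI [of _ q']) (simp_all add: word_value_append)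
  qed
  then have cover: "\<exists>q\<in>Q. same_coset ?K x q" if "x \<in> carrier G" for x
    using that nf_letters [of x] by (metis word_value_nf)
  show "H \<subseteq> ?K"
  proof
    fix h assume h: "h \<in> H"
    then have hc: "h \<in> carrier G" using H_closed by auto
    obtain q where q: "q \<in> Q" "same_coset ?K h q" using cover hc by blast
    have "?K \<subseteq> H" by fact
    then have "same_coset H h q" using q by (auto simp: same_coset_def)
    moreover have "same_coset H h \<one>" using h hc by (simp add: same_coset_def)
    ultimately have "q = \<one>"
      using rep_eqI [OF hc q(1)] rep_eqI [OF hc one_Q] by simp
    then show "h \<in> ?K" using q hc by (simp add: same_coset_def)
  qed
qed

end

section \<open>Rank and extension of partial transversals\<close>

context free_group
begin

text \<open>The normal form of a product is the free reduction of the concatenated normal forms, and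
  reduction keeps parities.\<close>

lemma even_occurrences_nf_mult:
  assumes "x \<in> carrier G" "y \<in> carrier G"
  shows "even (occurrences C (nf (x \<otimes> y))) \<longleftrightarrow>
    (even (occurrences C (nf x)) \<longleftrightarrow> even (occurrences C (nf y)))"
proof -
  have S: "fst ` set (nf x) \<subseteq> S" "fst ` set (nf y) \<subseteq> S" "fst ` set (nf x @ nf y) \<subseteq> S"
    using assms nf_letters by auto
  have "nf (x \<otimes> y) = free_reduction (nf x @ nf y)"
  proof (rule nf_eqI)
    show "fst ` set (free_reduction (nf x @ nf y)) \<subseteq> S"
      using image_mono [OF set_free_reduction] S(3) by (rule subset_trans)
    show "word_value G (free_reduction (nf x @ nf y)) = x \<otimes> y"
      using assms letters_closed [OF S(1)] letters_closed [OF S(2)] letters_closed [OF S(3)]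
      by (simp only: word_value_free_reduction word_value_append word_value_nf)
  qed (rule reduced_free_reduction)
  then show ?thesis by (simp add: even_occurrences_free_reduction)
qed

lemma even_occurrences_nf_inv:
  assumes "x \<in> carrier G"
  shows "even (occurrences C (nf (inv x))) \<longleftrightarrow> even (occurrences C (nf x))"
  using even_occurrences_nf_mult [of x "inv x" C] assms by auto

text \<open>The parities of the numbers of occurrences of the letters in \<open>C\<close>, for \<open>C \<subseteq> S\<close>, are pairwise
  distinct homomorphisms to the group of order two, and each is determined by its values on \<open>T\<close>.\<close>

lemma card_basis_le:
  assumes T: "finite T" "T \<subseteq> carrier G" "generate G T = carrier G"
  shows "finite S \<and> card S \<le> card T"
proof -
  define \<chi> where "\<chi> C x \<longleftrightarrow> even (occurrences C (nf x))" for C x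
  have "C = D" if CD: "C \<subseteq> S" "D \<subseteq> S" "{t \<in> T. \<chi> C t} = {t \<in> T. \<chi> D t}" for C D
  proof -
    have "\<chi> C x = \<chi> D x" if "x \<in> generate G T" for x
      using that
    proof induction
      case (eng x y)
      then show ?case
        using T by (simp add: \<chi>_def even_occurrences_nf_mult)
    qed (use CD(3) T in \<open>auto simp: \<chi>_def even_occurrences_nf_inv subset_iff\<close>)
    then have *: "\<chi> C x = \<chi> D x" if "x \<in> S" for x
      using that basis_subset T by auto
    have "\<chi> C x \<longleftrightarrow> x \<notin> C" if "x \<in> S" for C x
      using that nf_letter [of "(x, True)"] by (simp add: \<chi>_def)
    then show ?thesis using * CD by auto
  qed
  then have inj: "inj_on (\<lambda>C. {t \<in> T. \<chi> C t}) (Pow S)" by (auto intro!: inj_onI)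
  have sub: "(\<lambda>C. {t \<in> T. \<chi> C t}) ` Pow S \<subseteq> Pow T" by auto
  have "finite (Pow S)" using inj_on_finite [OF inj sub] T by simp
  moreover have "card (Pow S) \<le> card (Pow T)" using card_inj_on_le [OF inj sub] T by simp
  ultimately show ?thesis using T by (simp add: card_Pow)
qed

text \<open>The pieces map injectively and disjointly to the Schreier graph, so they form a forest
  there, which extends to a spanning tree. Lifting that tree to the Cayley tree may move each piece
  by an element of \<open>H\<close>. Zorn's lemma is applied to partial lifts.\<close>

lemma exists_schreier_domain:
  assumes H: "subgroup H G"
    and a: "\<And>i. i \<in> I \<Longrightarrow> a i \<in> carrier G" and P: "\<And>i. i \<in> I \<Longrightarrow> convex (P i)"
    and inj: "\<And>i j u v. i \<in> I \<Longrightarrow> j \<in> I \<Longrightarrow> u \<in> P i \<Longrightarrow> v \<in> P j \<Longrightarrow>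
      same_coset H (a i \<otimes> u) (a j \<otimes> v) \<Longrightarrow> i = j \<and> u = v"
  shows "\<exists>Q. schreier_domain G S H Q \<and> (\<forall>i\<in>I. \<exists>h\<in>H. (\<lambda>u. h \<otimes> a i \<otimes> u) ` P i \<subseteq> Q)"
proof -
  define absorbs where "absorbs Q i \<longleftrightarrow> (\<exists>h\<in>H. (\<lambda>u. h \<otimes> a i \<otimes> u) ` P i \<subseteq> Q)" for Q i
  define covers where "covers Q x \<longleftrightarrow> (\<exists>q\<in>Q. same_coset H x q)" for Q x
  \<comment> \<open>A partial lift must take a piece entirely or not meet it modulo
    \<open>H\<close>; otherwise a maximal one could cut a piece in two.\<close>
  define admissible where "admissible Q \<longleftrightarrow> convex Q \<and>
      (\<forall>q\<in>Q. \<forall>q'\<in>Q. same_coset H q q' \<longrightarrow> q = q') \<and>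
      (\<forall>i\<in>I. \<forall>u\<in>P i. covers Q (a i \<otimes> u) \<longrightarrow> absorbs Q i)" for Q
  have Hc: "H \<subseteq> carrier G" using H by (simp add: subgroup.subset)
  have Pc: "u \<in> carrier G" if "i \<in> I" "u \<in> P i" for i u using P that convex_subset by auto
  note sc_iff = same_coset_iff_r_coset [OF H]
  have adm_closed: "Q \<subseteq> carrier G" if "admissible Q" for Q
    using that convex_subset by (auto simp: admissible_def)
  have adm_unique: "q = q'" if "admissible Q" "q \<in> Q" "q' \<in> Q" "same_coset H q q'" for Q q q'
    using that by (auto simp: admissible_def)
  have adm_convex: "convex Q" if "admissible Q" for Q
    using that by (auto simp: admissible_def)
  have adm_absorbs: "absorbs Q i" if "admissible Q" "i \<in> I" "u \<in> P i" "covers Q (a i \<otimes> u)" for Q i u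
    using that by (auto simp: admissible_def)
  \<comment> \<open>\<open>R\<close> is the unit that can be attached at \<open>c\<close>: the
    translated piece through \<open>c\<close> if there is one, and \<open>{c}\<close> otherwise. By
    the last conjunct, if \<open>Q\<close> does not cover \<open>c\<close>, it covers no vertex of
    \<open>R\<close>.\<close>
  have block: "\<exists>R. admissible R \<and> c \<in> R \<and>
      (\<forall>Q. admissible Q \<longrightarrow> (\<exists>r\<in>R. covers Q r) \<longrightarrow> covers Q c)" if c: "c \<in> carrier G" for c
  proof (cases "\<exists>i\<in>I. \<exists>u\<in>P i. same_coset H c (a i \<otimes> u)")
    case True
    then obtain i u where i: "i \<in> I" "u \<in> P i" "same_coset H c (a i \<otimes> u)" by blast
    have ai: "a i \<in> carrier G" using a i by simp
    have Pi: "v \<in> carrier G" if "v \<in> P i" for v using Pc i that by blast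
    \<comment> \<open>\<open>h\<close> moves the piece so that its vertex \<open>u\<close> lands on
      \<open>c\<close> itself, not merely in the coset of \<open>c\<close>: the edge that will join
      the piece has to end at \<open>c\<close>.\<close>
    define h where "h = c \<otimes> inv (a i \<otimes> u)"
    have h: "h \<in> H" "h \<in> carrier G" using i Hc by (auto simp: h_def same_coset_def)
    let ?R = "(\<lambda>u. h \<otimes> a i \<otimes> u) ` P i"
    have sc: "same_coset H (h \<otimes> a i \<otimes> v) (a i \<otimes> v)" if "v \<in> P i" for v
      using same_coset_mult_left [OF H h(1), of "a i \<otimes> v"] that ai Pi h by (simp add: m_assoc)
    have cR: "c = h \<otimes> a i \<otimes> u" using c i ai Pi by (simp add: h_def group_word_simps)
    have "convex ?R"
      using convex_translate [of "P i" "h \<otimes> a i"] P i ai h by simp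
    moreover have "v = w" if "v \<in> P i" "w \<in> P i" "same_coset H (h \<otimes> a i \<otimes> v) (h \<otimes> a i \<otimes> w)" for v w
    proof -
      have "same_coset H (a i \<otimes> v) (a i \<otimes> w)"
        using that sc [of v] sc [of w] ai h Pi by (simp add: sc_iff)
      then show ?thesis using inj i that by blast
    qed
    moreover have "absorbs ?R j"
      if j: "j \<in> I" "v \<in> P j" "w \<in> P i" "same_coset H (a j \<otimes> v) (h \<otimes> a i \<otimes> w)" for j v w
    proof -
      have "same_coset H (a j \<otimes> v) (a i \<otimes> w)"
        using that sc [of w] ai a [OF j(1)] Pc [OF j(1,2)] h Pi by (simp add: sc_iff)
      then have "j = i" using inj i j by blast
      then show ?thesis using h by (auto simp: absorbs_def)
    qed
    ultimately have "admissible ?R"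
      by (auto simp: admissible_def covers_def)
    moreover have "covers Q c" if Q: "admissible Q" "v \<in> P i" "covers Q (h \<otimes> a i \<otimes> v)" for Q v
    proof -
      obtain q where q: "q \<in> Q" "same_coset H (h \<otimes> a i \<otimes> v) q" using Q by (auto simp: covers_def)
      have qc: "q \<in> carrier G" using q adm_closed Q by blast
      have "same_coset H (a i \<otimes> v) q"
        using that sc [of v] ai h Pi q qc by (simp add: sc_iff)
      then obtain h' where h': "h' \<in> H" "(\<lambda>u. h' \<otimes> a i \<otimes> u) ` P i \<subseteq> Q"
        using adm_absorbs [OF Q(1) i(1) Q(2)] q by (auto simp: covers_def absorbs_def)
      have h'c: "h' \<in> carrier G" using h' Hc by auto
      have "same_coset H (h' \<otimes> a i \<otimes> u) (a i \<otimes> u)"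
        using same_coset_mult_left [OF H h'(1), of "a i \<otimes> u"] i ai Pi h'c by (simp add: m_assoc)
      then have "same_coset H c (h' \<otimes> a i \<otimes> u)"
        using i ai Pi h'c c by (simp add: sc_iff)
      then show ?thesis using h' i by (auto simp: covers_def)
    qed
    ultimately show ?thesis using cR i by (intro exI [of _ ?R]) auto
  next
    case False
    then have "\<not> same_coset H (a i \<otimes> u) c" if "i \<in> I" "u \<in> P i" for i u
      using that c same_coset_sym [OF H _ c] a [OF that(1)] Pc [OF that] by (meson m_closed)
    then have "admissible {c}"
      using c by (auto simp: admissible_def covers_def)
    then show ?thesis by (intro exI [of _ "{c}"]) auto
  qed
  have "\<exists>M\<in>Collect admissible. \<forall>Q\<in>Collect admissible. M \<subseteq> Q \<longrightarrow> Q = M"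
  proof (rule subset_Zorn_nonempty)
    show "Collect admissible \<noteq> {}"
      by (auto simp: admissible_def covers_def intro!: exI [of _ "{}"])
    fix \<C> assume \<C>: "\<C> \<noteq> {}" "subset.chain (Collect admissible) \<C>"
    have adm: "admissible Q" if "Q \<in> \<C>" for Q using \<C> that by (auto simp: subset_chain_def)
    have chain: "Q \<subseteq> Q' \<or> Q' \<subseteq> Q" if "Q \<in> \<C>" "Q' \<in> \<C>" for Q Q'
      using \<C> that by (auto simp: subset_chain_def)
    have "convex (\<Union>\<C>)"
      using adm_convex adm chain by (intro convex_Union_chain) auto
    moreover have "q = q'" if "q \<in> Q" "Q \<in> \<C>" "q' \<in> Q'" "Q' \<in> \<C>" "same_coset H q q'" for q q' Q Q'
      using that adm_unique adm chain by (metis subsetD)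
    moreover have "absorbs (\<Union>\<C>) i"
      if "i \<in> I" "u \<in> P i" "q \<in> Q" "Q \<in> \<C>" "same_coset H (a i \<otimes> u) q" for i u q Q
    proof -
      have "absorbs Q i" using adm_absorbs [of Q i u] that adm by (auto simp: covers_def)
      then show ?thesis using that unfolding absorbs_def by blast
    qed
    ultimately show "\<Union>\<C> \<in> Collect admissible"
      by (auto simp: admissible_def covers_def)
  qed
  then obtain M where M: "admissible M" and max: "\<And>Q. admissible Q \<Longrightarrow> M \<subseteq> Q \<Longrightarrow> Q = M" by auto
  have Mc: "M \<subseteq> carrier G" using adm_closed M .
  have "M \<noteq> {}"
  proof
    assume "M = {}"
    moreover obtain R where "admissible R" "\<one> \<in> R" using block by blast
    ultimately show False using max by blast
  qed
  then obtain q\<^sub>0 where q\<^sub>0: "q\<^sub>0 \<in> M" by blast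
  \<comment> \<open>An uncovered neighbour of \<open>M\<close> would allow its whole unit to be
    joined to \<open>M\<close> along that edge, against maximality.\<close>
  have step: "covers M (q \<otimes> letter_value l)" if q: "q \<in> M" and l: "fst l \<in> S" for q l
  proof (rule ccontr)
    let ?c = "q \<otimes> letter_value l"
    assume nc: "\<not> covers M ?c"
    have c: "?c \<in> carrier G" using q l Mc by auto
    obtain R where R: "admissible R" "?c \<in> R" "\<And>r. r \<in> R \<Longrightarrow> \<not> covers M r"
      using block [OF c] nc M by blast
    have Rc: "R \<subseteq> carrier G" using adm_closed R by blast
    have disj: "\<not> same_coset H q r" "\<not> same_coset H r q" if "q \<in> M" "r \<in> R" for q r
      using R(3) [of r] that Mc Rc by (auto simp: covers_def sc_iff subset_iff)
    have "M \<inter> R = {}" using disj H Mc by force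
    then have "convex (M \<union> R)"
      using convex_Un [OF adm_convex adm_convex _ q l] M R by blast
    moreover have "absorbs (M \<union> R) i" if "i \<in> I" "u \<in> P i" "covers (M \<union> R) (a i \<otimes> u)" for i u
    proof -
      have "covers M (a i \<otimes> u) \<or> covers R (a i \<otimes> u)" using that by (auto simp: covers_def)
      then have "absorbs M i \<or> absorbs R i" using adm_absorbs M R that by blast
      then show ?thesis unfolding absorbs_def by blast
    qed
    ultimately have "admissible (M \<union> R)"
      using adm_unique [OF M] adm_unique [OF R(1)] disj by (auto simp: admissible_def)
    then have "?c \<in> M" using max [of "M \<union> R"] R by blast
    then show False using nc H c by (auto simp: covers_def)
  qed
  have words: "covers M (q\<^sub>0 \<otimes> word_value G w)" if "fst ` set w \<subseteq> S" for w
    using that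
  proof (induction w rule: rev_induct)
    case Nil
    have "q\<^sub>0 \<in> carrier G" using q\<^sub>0 Mc by blast
    then show ?case using q\<^sub>0 H by (auto simp: covers_def intro!: bexI [of _ q\<^sub>0])
  next
    case (snoc l w)
    then obtain q where q: "q \<in> M" "same_coset H (q\<^sub>0 \<otimes> word_value G w) q" by (auto simp: covers_def)
    obtain q' where q': "q' \<in> M" "same_coset H (q \<otimes> letter_value l) q'"
      using step [OF q(1), of l] snoc.prems by (auto simp: covers_def)
    have c: "q \<in> carrier G" "q' \<in> carrier G" "q\<^sub>0 \<in> carrier G" "letter_value l \<in> carrier G"
        "fst ` set w \<subseteq> carrier G" "fst l \<in> carrier G"
      using q q' q\<^sub>0 Mc snoc.prems letters_closed basis_subset by auto
    have "same_coset H (q\<^sub>0 \<otimes> word_value G w \<otimes> letter_value l) (q \<otimes> letter_value l)"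
      using q c by (subst same_coset_mult_right) auto
    then have "same_coset H (q\<^sub>0 \<otimes> word_value G w \<otimes> letter_value l) q'"
      using q'(2) c by (simp add: sc_iff)
    then show ?case
      using q' c by (auto simp: covers_def word_value_append m_assoc)
  qed
  have all: "covers M x" if "x \<in> carrier G" for x
  proof -
    have "inv q\<^sub>0 \<otimes> x \<in> carrier G" using that q\<^sub>0 Mc by auto
    then show ?thesis
      using words [of "nf (inv q\<^sub>0 \<otimes> x)"] nf_letters that q\<^sub>0 Mc by auto
  qed
  \<comment> \<open>\<open>M\<close> need not contain \<one>, but it represents the coset
    \<open>H\<close> by some \<open>k\<close>; translating by \<open>inv k\<close>, an element of
    \<open>H\<close>, changes no coset and moves \<open>k\<close> to \<one>.\<close>
  obtain k where k: "k \<in> M" "same_coset H \<one> k" using all [of \<one>] by (auto simp: covers_def)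
  have kc: "k \<in> carrier G" using k Mc by auto
  then have kH: "inv k \<in> H" using k by (simp add: same_coset_def)
  let ?Q = "(\<otimes>) (inv k) ` M"
  have sck: "same_coset H (inv k \<otimes> x) x" "same_coset H x (inv k \<otimes> x)" if "x \<in> carrier G" for x
    using same_coset_mult_left [OF H kH that] that kc by (simp_all add: sc_iff)
  have "schreier_domain G S H ?Q"
  proof
    show "convex ?Q" using convex_translate adm_convex M kc by simp
    show "\<one> \<in> ?Q" using k kc by (auto intro!: image_eqI [of _ _ k])
    fix x assume x: "x \<in> carrier G"
    then obtain q where q: "q \<in> M" "same_coset H x q" using all by (auto simp: covers_def)
    then have "same_coset H x (inv k \<otimes> q)"
      using sck(2) [of q] x Mc kc by (auto simp: sc_iff subset_iff)
    then show "\<exists>q\<in>?Q. same_coset H x q" using q by blast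
  next
    fix q q' assume "q \<in> ?Q" "q' \<in> ?Q" and sc: "same_coset H q q'"
    then obtain x y where xy: "x \<in> M" "y \<in> M" "q = inv k \<otimes> x" "q' = inv k \<otimes> y" by blast
    then have "same_coset H x y"
      using sc sck(1) [of x] sck(1) [of y] Mc kc by (auto simp: sc_iff subset_iff)
    then show "q = q'" using xy adm_unique M by blast
  qed (use H in \<open>auto simp: subgroup_def\<close>)
  moreover have "\<exists>h\<in>H. (\<lambda>u. h \<otimes> a i \<otimes> u) ` P i \<subseteq> ?Q" if i: "i \<in> I" for i
  proof (cases "P i = {}")
    case True
    then show ?thesis using kH by blast
  next
    case False
    then obtain u where u: "u \<in> P i" by blast
    then have "absorbs M i" using adm_absorbs [OF M i] all i a Pc by simp
    then obtain h where h: "h \<in> H" "\<And>v. v \<in> P i \<Longrightarrow> h \<otimes> a i \<otimes> v \<in> M" by (auto simp: absorbs_def)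
    have "inv k \<otimes> h \<in> H" using h kH H by (simp add: subgroup.m_closed)
    moreover have "inv k \<otimes> h \<otimes> a i \<otimes> v \<in> ?Q" if v: "v \<in> P i" for v
    proof -
      have "inv k \<otimes> h \<otimes> a i \<otimes> v = inv k \<otimes> (h \<otimes> a i \<otimes> v)"
        using i a Pc kc h(1) Hc v by (auto simp: m_assoc)
      then show ?thesis using h(2) [OF v] by simp
    qed
    ultimately show ?thesis by blast
  qed
  ultimately show ?thesis by blast
qed

end

section \<open>Free factor systems from blocks of a basis\<close>

lemma image_Collect_mem: "B \<subseteq> f ` A \<Longrightarrow> f ` {x \<in> A. f x \<in> B} = B"
  by blast

context group
begin

text \<open>Substituting for each factor a reduced word over its block gives a reduced word over
  \<open>B\<close>: consecutive factors use disjoint sets of letters, so nothing cancels at the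
  seams.\<close>

lemma generates_free_product_blocks:
  assumes B: "free_set B" and sub: "\<And>i. i \<in> I \<Longrightarrow> \<beta> i \<subseteq> B"
    and disj: "\<And>i j. i \<in> I \<Longrightarrow> j \<in> I \<Longrightarrow> i \<noteq> j \<Longrightarrow> \<beta> i \<inter> \<beta> j = {}"
  shows "generates_free_product G I (\<lambda>i. generate G (\<beta> i))"
proof -
  have Bc: "B \<subseteq> carrier G" using B by (simp add: free_set_def)
  define wd where
    "wd p = (SOME v. fst ` set v \<subseteq> \<beta> (fst p) \<and> reduced_word v \<and> word_value G v = snd p)" for p
  have wd: "fst ` set (wd (i, a)) \<subseteq> \<beta> i \<and> reduced_word (wd (i, a)) \<and> word_value G (wd (i, a)) = a"
    if i: "i \<in> I" "a \<in> generate G (\<beta> i)" for i a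
  proof -
    obtain v where "fst ` set v \<subseteq> \<beta> i" "reduced_word v" "word_value G v = a"
      using generate_reduced_wordE [OF _ i(2)] sub [OF i(1)] Bc by (metis subset_trans)
    then have "\<exists>v. fst ` set v \<subseteq> \<beta> i \<and> reduced_word v \<and> word_value G v = a" by blast
    then show ?thesis unfolding wd_def fst_conv snd_conv by (rule someI_ex)
  qed
  \<comment> \<open>The last conjunct records the block of the first letter, which the induction
    compares with the last letter of the word put in front.\<close>
  have main: "fst ` set (concat (map wd w)) \<subseteq> B \<and> reduced_word (concat (map wd w)) \<and>
      word_value G (concat (map wd w)) = foldr (\<otimes>) (map snd w) \<one> \<and>
      (w \<noteq> [] \<longrightarrow> concat (map wd w) \<noteq> [] \<and> fst (hd (concat (map wd w))) \<in> \<beta> (fst (hd w)))"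
    if "\<forall>(i, a)\<in>set w. i \<in> I \<and> a \<in> generate G (\<beta> i) \<and> a \<noteq> \<one>"
      "successively (\<lambda>p q. fst p \<noteq> fst q) w" for w
    using that
  proof (induction w)
    case (Cons p w)
    obtain i a where p: "p = (i, a)" by fastforce
    have i: "i \<in> I" "a \<in> generate G (\<beta> i)" "a \<noteq> \<one>" using Cons.prems p by auto
    let ?v = "wd p" and ?r = "concat (map wd w)"
    have v: "fst ` set ?v \<subseteq> \<beta> i" "reduced_word ?v" "word_value G ?v = a"
      using wd i p by auto
    have vne: "?v \<noteq> []" using v i by auto
    have "successively (\<lambda>p q. fst p \<noteq> fst q) w" using Cons.prems by (auto simp: successively_Cons)
    then have IH: "fst ` set ?r \<subseteq> B" "reduced_word ?r" "word_value G ?r = foldr (\<otimes>) (map snd w) \<one>"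
      "w \<noteq> [] \<Longrightarrow> ?r \<noteq> [] \<and> fst (hd ?r) \<in> \<beta> (fst (hd w))"
      using Cons by auto
    have vB: "fst ` set ?v \<subseteq> B" using v sub [OF i(1)] by blast
    have "hd ?r \<noteq> flip (last ?v)" if "?r \<noteq> []"
    proof
      assume *: "hd ?r = flip (last ?v)"
      have wne: "w \<noteq> []" using that by auto
      obtain j b where j: "hd w = (j, b)" by fastforce
      have "(j, b) \<in> set w" using j wne by (metis hd_in_set)
      then have "j \<in> I" "j \<noteq> i"
        using Cons.prems p j wne by (auto simp: successively_Cons)
      moreover have "fst (hd ?r) \<in> \<beta> j" using IH(4) wne j by simp
      moreover have "fst (hd ?r) \<in> \<beta> i" using v(1) vne * by auto
      ultimately show False using disj i by blast
    qed
    then have "reduced_word (?v @ ?r)" using v IH by (auto simp: reduced_append)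
    moreover have "word_value G (?v @ ?r) = a \<otimes> foldr (\<otimes>) (map snd w) \<one>"
      using v IH vB Bc by (subst word_value_append) auto
    moreover have "fst (hd ?v) \<in> \<beta> i" using v(1) vne by auto
    moreover have "fst ` set (?v @ ?r) \<subseteq> B" using vB IH(1) by (simp only: set_append image_Un) simp
    ultimately show ?case using p vne by simp
  qed simp
  show ?thesis
    unfolding generates_free_product_def
  proof (intro conjI ballI allI impI)
    fix i assume "i \<in> I"
    then show "subgroup (generate G (\<beta> i)) G"
      using sub Bc by (intro generate_is_subgroup) blast
  next
    fix w
    assume w: "w \<noteq> []" "\<forall>(i, a)\<in>set w. i \<in> I \<and> a \<in> generate G (\<beta> i) \<and> a \<noteq> \<one>"
      "successively (\<lambda>p q. fst p \<noteq> fst q) w"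
    then show "foldr (\<otimes>) (map snd w) \<one> \<noteq> \<one>"
      using main [OF w(2,3)] B unfolding free_set_def by metis
  qed
qed

text \<open>The complementary factor is generated by \<open>B - C\<close>.\<close>

lemma free_factor_generate:
  assumes B: "free_basis G B" and C: "C \<subseteq> B"
  shows "free_factor G (generate G C)"
proof -
  have Bc: "B \<subseteq> carrier G" "generate G B = carrier G" "free_set B"
    using B by (auto simp: free_basis_iff free_set_def)
  have eq: "(\<lambda>b. if b then generate G C else generate G (B - C)) = (\<lambda>b. generate G (if b then C else B - C))"
    by (simp add: fun_eq_iff)
  have "generates_free_product G (UNIV :: bool set) (\<lambda>b. generate G (if b then C else B - C))"
    using Bc C by (intro generates_free_product_blocks [of B]) auto
  moreover have "generate G (\<Union>b\<in>UNIV. generate G (if b then C else B - C)) = carrier G"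
  proof
    have "generate G (if b then C else B - C) \<subseteq> carrier G" for b
      using Bc C by (intro generate_incl) auto
    then show "generate G (\<Union>b\<in>UNIV. generate G (if b then C else B - C)) \<subseteq> carrier G"
      by (intro generate_incl) auto
    have "B \<subseteq> (\<Union>b\<in>UNIV. generate G (if b then C else B - C))"
      by (auto simp: UNIV_bool intro: generate.incl)
    then show "carrier G \<subseteq> generate G (\<Union>b\<in>UNIV. generate G (if b then C else B - C))"
      using Bc(2) mono_generate by metis
  qed
  ultimately have "is_free_product G UNIV (\<lambda>b. if b then generate G C else generate G (B - C))"
    unfolding eq is_free_product_def by (rule conjI)
  then show ?thesis unfolding free_factor_def by (rule exI)
qed

lemma nontrivial_free_factor_system_blocks:
  assumes B: "free_basis G B" and fin: "finite \<A>" "\<A> \<noteq> {}"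
    and sub: "\<And>A. A \<in> \<A> \<Longrightarrow> \<beta> A \<subseteq> B" and gen: "\<And>A. A \<in> \<A> \<Longrightarrow> A = generate G (\<beta> A)"
    and nontrivial: "\<And>A. A \<in> \<A> \<Longrightarrow> A \<noteq> {\<one>}"
    and disj: "\<And>A A'. A \<in> \<A> \<Longrightarrow> A' \<in> \<A> \<Longrightarrow> A \<noteq> A' \<Longrightarrow> \<beta> A \<inter> \<beta> A' = {}"
  shows "nontrivial_free_factor_system G \<A>"
proof -
  have Bc: "B \<subseteq> carrier G" "free_set B" using B by (auto simp: free_basis_iff free_set_def)
  have "generates_free_product G \<A> (\<lambda>A. generate G (\<beta> A))"
    using Bc sub disj by (intro generates_free_product_blocks) auto
  then have gfp: "generates_free_product G \<A> (\<lambda>A. A)"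
    unfolding generates_free_product_def using gen by (simp add: case_prod_beta)
  have bc: "\<Union>(\<beta> ` \<A>) \<subseteq> carrier G" using sub Bc by blast
  have "generate G (\<Union>\<A>) = generate G (\<Union>(\<beta> ` \<A>))"
  proof
    have "A \<subseteq> generate G (\<Union>(\<beta> ` \<A>))" if "A \<in> \<A>" for A
      using gen [OF that] mono_generate [of "\<beta> A" "\<Union>(\<beta> ` \<A>)"] that by blast
    then show "generate G (\<Union>\<A>) \<subseteq> generate G (\<Union>(\<beta> ` \<A>))"
      using generate_is_subgroup [OF bc] by (intro generate_subgroup_incl) auto
    have "\<beta> A \<subseteq> A" if "A \<in> \<A>" for A
      using gen [OF that] generate.incl [of _ "\<beta> A"] by blast
    then show "generate G (\<Union>(\<beta> ` \<A>)) \<subseteq> generate G (\<Union>\<A>)"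
      by (intro mono_generate) blast
  qed
  then have "free_factor G (generate G (\<Union>\<A>))"
    using free_factor_generate [OF B] sub by (metis UN_least)
  moreover have "free_factor G A" if "A \<in> \<A>" for A
    using gen [OF that] free_factor_generate [OF B sub [OF that]] by simp
  ultimately show ?thesis
    using fin nontrivial gfp by (auto simp: nontrivial_free_factor_system_def)
qed

lemma free_factor_subgroup:
  assumes "free_factor G A"
  shows "subgroup A G"
proof -
  obtain K where "generates_free_product G (UNIV :: bool set) (\<lambda>b. if b then A else K)"
    using assms unfolding free_factor_def is_free_product_def by blast
  then have "\<forall>b. subgroup (if b then A else K) G" unfolding generates_free_product_def by blast
  from this [rule_format, of True] show ?thesis by simp
qed

lemma free_factor_system_subgroup:
  "free_factor_system G \<A> \<Longrightarrow> A \<in> \<A> \<Longrightarrow> subgroup A G"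
  using free_factor_subgroup triv_subgroup
  unfolding free_factor_system_def nontrivial_free_factor_system_def trivial_system_def
  by (metis singletonD)

lemma generate_hom_image:
  assumes "\<psi> \<in> hom G G" "C \<subseteq> carrier G"
  shows "generate G (\<psi> ` C) = \<psi> ` generate G C"
proof -
  interpret \<psi>: group_hom G G \<psi>
    using assms(1) by (simp add: group_hom_def group_hom_axioms_def is_group)
  show ?thesis using \<psi>.generate_img assms(2) by simp
qed

text \<open>\<open>\<psi>\<close> is an isomorphism onto its image, so bases of the image pull back
  to bases of \<open>G\<close>. This both bounds the rank of \<open>H n\<close> and carries blocks
  at level \<open>n\<close> back to the whole group.\<close>

lemma free_basis_vimage:
  assumes \<psi>: "\<psi> \<in> hom G G" "inj_on \<psi> (carrier G)"
    and B: "free_set B" "generate G B = \<psi> ` carrier G"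
  shows "free_basis G {x \<in> carrier G. \<psi> x \<in> B}"
proof -
  let ?B = "{x \<in> carrier G. \<psi> x \<in> B}"
  have img: "\<psi> ` ?B = B"
  proof -
    have "B \<subseteq> \<psi> ` carrier G" using B(2) generate.incl [of _ B G] by blast
    then show ?thesis by (rule image_Collect_mem)
  qed
  have c: "generate G ?B \<subseteq> carrier G" by (rule generate_incl) auto
  have "\<psi> ` generate G ?B = \<psi> ` carrier G"
    using generate_hom_image [OF \<psi>(1), of ?B] img B by auto
  then have "generate G ?B = carrier G"
    using \<psi>(2) c by (simp add: inj_on_image_eq_iff)
  moreover have "word_value G w \<noteq> \<one>"
    if w: "w \<noteq> []" "fst ` set w \<subseteq> ?B" "reduced_word w" for w
  proof
    assume one: "word_value G w = \<one>"
    let ?v = "map (map_prod \<psi> id) w"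
    have "word_value G ?v = \<psi> \<one>"
      using word_value_hom [OF \<psi>(1)] w one by (metis (no_types, lifting) mem_Collect_eq subset_iff)
    moreover have "\<psi> \<one> = \<one>" using \<psi>(1) hom_one is_group by blast
    moreover have "fst ` set ?v \<subseteq> B" using w by auto
    moreover have "reduced_word ?v"
    proof -
      have "flip (map_prod \<psi> id l) \<noteq> map_prod \<psi> id m"
        if "l \<in> set w" "m \<in> set w" "m \<noteq> flip l" for l m
      proof -
        have "fst l \<in> carrier G" "fst m \<in> carrier G" using w that by auto
        then show ?thesis
          using that inj_onD [OF \<psi>(2), of "fst l" "fst m"] by (cases l; cases m) auto
      qed
      then have "successively (\<lambda>l m. map_prod \<psi> id m \<noteq> flip (map_prod \<psi> id l)) w"
        using w(3) unfolding reduced_word_iff by (rule_tac successively_mono) fastforce+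
      then show ?thesis by (simp add: reduced_word_iff successively_map)
    qed
    ultimately show False using B(1) w(1) unfolding free_set_def by (metis map_is_Nil_conv)
  qed
  ultimately show ?thesis by (auto simp: free_basis_iff free_set_def)
qed

end

section \<open>Rank and fixed cosets of an isomorphic image; comparison of Schreier
  generators\<close>

context schreier_domain
begin

text \<open>The Schreier generators form a basis of \<open>H\<close>; pulled back along
  \<open>\<psi>\<close> it becomes a basis of the whole group, which has at most
  \<open>card S\<close> elements because \<open>S\<close> generates.\<close>

lemma leaving_edges_finite:
  assumes "finite S" "\<psi> \<in> hom G G" "inj_on \<psi> (carrier G)" "H = \<psi> ` carrier G"
  shows "finite leaving_edges \<and> card leaving_edges \<le> card S"
proof -
  let ?B = "{x \<in> carrier G. \<psi> x \<in> gen ` leaving_edges}"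
  have B: "free_basis G ?B"
    using free_basis_vimage [OF assms(2,3) free_set_gen] generate_gen assms(4) by simp
  interpret B: free_group G ?B by unfold_locales (rule B)
  have "finite ?B \<and> card ?B \<le> card S"
    using B.card_basis_le [OF assms(1) basis_subset generate_basis] .
  moreover have "gen ` leaving_edges \<subseteq> \<psi> ` carrier G"
    using gen_in_H assms(4) by blast
  then have "\<psi> ` ?B = gen ` leaving_edges" by (rule image_Collect_mem)
  moreover have "inj_on \<psi> ?B" using assms(3) by (rule inj_on_subset) auto
  ultimately have "finite (gen ` leaving_edges) \<and> card (gen ` leaving_edges) \<le> card S"
    using finite_imageI [of ?B \<psi>] card_image [of \<psi> ?B] by metis
  then show ?thesis
    using inj_on_gen finite_imageD [OF _ inj_on_gen] card_image [OF inj_on_gen] by simp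
qed

text \<open>If \<open>q \<otimes> g \<otimes> inv q \<in> H\<close>, then the path from \<open>q\<close> spelled by \<open>g\<close> ends at another vertex of the
  coset of \<open>q\<close>, so it leaves \<open>Q\<close>, and it can do so only at one of finitely many vertices.\<close>

lemma finite_fixed_cosets:
  assumes fin: "finite leaving_edges" and g: "g \<in> carrier G" "g \<noteq> \<one>"
  shows "finite {q \<in> Q. q \<otimes> g \<otimes> inv q \<in> H}"
proof -
  let ?D = "departure ` (leaving_edges \<times> UNIV)"
  let ?U = "word_value G ` (\<lambda>k. take k (nf g)) ` {..length (nf g)}"
  have "q \<in> (\<lambda>(d, u). d \<otimes> inv u) ` (?D \<times> ?U)" if q: "q \<in> Q" "q \<otimes> g \<otimes> inv q \<in> H" for q
  proof -
    have qc: "q \<in> carrier G" using q Q_closed by blast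
    define P where "P k \<longleftrightarrow> q \<otimes> word_value G (take k (nf g)) \<notin> Q" for k
    have "same_coset H (q \<otimes> g) q" using q by (simp add: same_coset_def)
    moreover have "q \<otimes> g \<noteq> q" using g qc by simp
    ultimately have "q \<otimes> g \<notin> Q" using coset_unique q by blast
    then have "P (length (nf g))" using g by (simp add: P_def)
    moreover have "\<not> P 0" using q qc by (simp add: P_def)
    \<comment> \<open>Prefix \<open>k\<close> ends inside \<open>Q\<close> and prefix
      \<open>Suc k\<close> outside. The exit vertex and the prefix together determine
      \<open>q\<close>, and both range over finite sets.\<close>
    ultimately obtain k where k: "\<not> P k" "P (Suc k)" "k < length (nf g)"
      using dec_induct [of 0 "length (nf g)" "\<lambda>k. \<not> P k"] by auto
    let ?u = "take k (nf g)" and ?l = "nf g ! k"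
    have "fst ` set (?u @ [?l]) \<subseteq> fst ` set (nf g)"
      using k(3) by (intro image_mono) (auto dest: in_set_takeD)
    then have S: "fst ` set (?u @ [?l]) \<subseteq> S" using nf_letters [OF g(1)] by blast
    then have u: "fst ` set ?u \<subseteq> carrier G" "fst ?l \<in> S" "fst ?l \<in> carrier G"
      using letters_closed [OF S] by auto
    have uc: "word_value G ?u \<in> carrier G" using u by simp
    have "word_value G (take (Suc k) (nf g)) = word_value G ?u \<otimes> letter_value ?l"
      using u k(3) by (simp add: take_Suc_conv_app_nth word_value_append)
    then have "q \<otimes> word_value G ?u \<otimes> letter_value ?l \<notin> Q"
      using k(2) qc uc u by (simp add: P_def m_assoc)
    then obtain m where "fst m \<in> leaving_edges" "departure m = q \<otimes> word_value G ?u"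
      using exists_departure [of "q \<otimes> word_value G ?u" ?l] k(1) u by (auto simp: P_def)
    then have "q \<otimes> word_value G ?u \<in> ?D" by (force intro: image_eqI [of _ _ m] simp: mem_Times_iff)
    moreover have "word_value G ?u \<in> ?U" using k(3) by auto
    moreover have "q = q \<otimes> word_value G ?u \<otimes> inv (word_value G ?u)"
      using qc uc by (simp add: m_assoc)
    ultimately show ?thesis by (intro image_eqI [of _ _ "(q \<otimes> word_value G ?u, word_value G ?u)"]) auto
  qed
  then have "{q \<in> Q. q \<otimes> g \<otimes> inv q \<in> H} \<subseteq> (\<lambda>(d, u). d \<otimes> inv u) ` (?D \<times> ?U)" by blast
  then show ?thesis using fin by (rule_tac finite_subset) auto
qed

end

text \<open>Left multiplication by \<open>c\<close> maps right cosets of \<open>M\<close> into right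
  cosets of \<open>H\<close>. If the start of the edge and the representative of its end both land
  in \<open>Q\<close>, that representative is preserved; and the moved edge leaves \<open>Q\<close>,
  since otherwise its end would equal the representative already before moving.\<close>

lemma (in free_group) schreier_gen_conjugate:
  assumes M: "schreier_domain G S M R" and H: "schreier_domain G S H Q"
    and c: "c \<in> carrier G" and conj: "\<And>m. m \<in> M \<Longrightarrow> c \<otimes> m \<otimes> inv c \<in> H"
    and e: "(u, s) \<in> schreier_domain.leaving_edges G S R"
    and Q: "c \<otimes> u \<in> Q" "c \<otimes> schreier_domain.rep G M R (u \<otimes> s) \<in> Q"
  shows "(c \<otimes> u, s) \<in> schreier_domain.leaving_edges G S Q \<and>
    schreier_domain.gen G H Q (c \<otimes> u, s) = c \<otimes> schreier_domain.gen G M R (u, s) \<otimes> inv c"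
proof -
  interpret M: schreier_domain G S M R by fact
  interpret H: schreier_domain G S H Q by fact
  let ?v = "M.rep (u \<otimes> s)"
  have us: "u \<in> carrier G" "s \<in> carrier G" "s \<in> S" "u \<otimes> s \<notin> R" "?v \<in> R" "?v \<in> carrier G"
    using M.leaving_edge [OF e] by auto
  have "c \<otimes> M.gen (u, s) \<otimes> inv c \<in> H" using M.gen_in_H [OF e] conj by blast
  then have sc: "same_coset H (c \<otimes> u \<otimes> s) (c \<otimes> ?v)"
    using us c by (simp add: M.gen_def same_coset_def group_word_simps)
  have "c \<otimes> u \<otimes> s \<notin> Q"
  proof
    assume "c \<otimes> u \<otimes> s \<in> Q"
    then have "c \<otimes> u \<otimes> s = c \<otimes> ?v" using H.coset_unique Q(2) sc by blast
    then have "u \<otimes> s = ?v" using us c by (simp add: m_assoc)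
    then show False using us by simp
  qed
  then have "(c \<otimes> u, s) \<in> H.leaving_edges" using Q us by (simp add: H.leaving_edges_def)
  moreover have "H.rep (c \<otimes> u \<otimes> s) = c \<otimes> ?v" using H.rep_eqI [OF _ Q(2) sc] us c by simp
  ultimately show ?thesis
    using us c by (simp add: H.gen_def M.gen_def group_word_simps)
qed

section \<open>The inverse limit of the coset spaces\<close>

context group
begin

lemma mem_l_coset_iff:
  assumes "K \<subseteq> carrier G" "x \<in> carrier G"
  shows "z \<in> x <# K \<longleftrightarrow> z \<in> carrier G \<and> inv x \<otimes> z \<in> K"
proof
  assume "z \<in> x <# K"
  then obtain k where "k \<in> K" "z = x \<otimes> k" by (auto simp: l_coset_def)
  moreover from this have "k \<in> carrier G" using assms by blast
  ultimately show "z \<in> carrier G \<and> inv x \<otimes> z \<in> K" using assms by simp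
next
  assume z: "z \<in> carrier G \<and> inv x \<otimes> z \<in> K"
  then have "z = x \<otimes> (inv x \<otimes> z)" using assms by simp
  then show "z \<in> x <# K" using z unfolding l_coset_def by blast
qed

lemma l_coset_eq_iff:
  assumes K: "subgroup K G" and x: "x \<in> carrier G" and y: "y \<in> carrier G"
  shows "x <# K = y <# K \<longleftrightarrow> inv x \<otimes> y \<in> K"
proof
  have Kc: "K \<subseteq> carrier G" using K by (simp add: subgroup.subset)
  assume "x <# K = y <# K"
  moreover have "y \<in> y <# K" using Kc y K by (simp add: mem_l_coset_iff subgroup.one_closed)
  ultimately have "y \<in> x <# K" by simp
  then show "inv x \<otimes> y \<in> K" using Kc x by (simp add: mem_l_coset_iff)
next
  have Kc: "K \<subseteq> carrier G" using K by (simp add: subgroup.subset)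
  assume "inv x \<otimes> y \<in> K"
  then have "y \<in> x <# K" using Kc x y by (simp add: mem_l_coset_iff)
  then show "x <# K = y <# K" using l_repr_independence x K by blast
qed

lemma mem_conj_subgroup_iff:
  assumes "A \<subseteq> carrier G" "x \<in> carrier G"
  shows "g \<in> conj_subgroup G x A \<longleftrightarrow> g \<in> carrier G \<and> inv x \<otimes> g \<otimes> x \<in> A"
proof
  assume "g \<in> conj_subgroup G x A"
  then obtain a where "a \<in> A" "g = x \<otimes> (a \<otimes> inv x)"
    by (auto simp: conj_subgroup_def l_coset_def r_coset_def)
  moreover from this have "a \<in> carrier G" using assms by blast
  ultimately show "g \<in> carrier G \<and> inv x \<otimes> g \<otimes> x \<in> A" using assms by (simp add: group_word_simps)
next
  assume g: "g \<in> carrier G \<and> inv x \<otimes> g \<otimes> x \<in> A"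
  then have "g = x \<otimes> ((inv x \<otimes> g \<otimes> x) \<otimes> inv x)" using assms by (simp add: group_word_simps)
  then show "g \<in> conj_subgroup G x A" using g by (fastforce simp: conj_subgroup_def l_coset_def r_coset_def)
qed

lemma conj_hom: "c \<in> carrier G \<Longrightarrow> (\<lambda>m. c \<otimes> m \<otimes> inv c) \<in> hom G G"
  by (auto simp: hom_def group_word_simps)

lemma conj_subgroup_eq_image:
  "A \<subseteq> carrier G \<Longrightarrow> c \<in> carrier G \<Longrightarrow> conj_subgroup G c A = (\<lambda>m. c \<otimes> m \<otimes> inv c) ` A"
  by (force simp: conj_subgroup_def l_coset_def r_coset_def m_assoc subset_iff)

lemma conj_subgroup_conj_subgroup:
  assumes A: "A \<subseteq> carrier G" and x: "x \<in> carrier G" and y: "y \<in> carrier G"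
  shows "conj_subgroup G x (conj_subgroup G y A) = conj_subgroup G (x \<otimes> y) A"
proof -
  have "(\<lambda>m. y \<otimes> m \<otimes> inv y) ` A \<subseteq> carrier G" using A y by auto
  moreover have "x \<otimes> (y \<otimes> m \<otimes> inv y) \<otimes> inv x = x \<otimes> y \<otimes> m \<otimes> inv (x \<otimes> y)" if "m \<in> A" for m
  proof -
    have "m \<in> carrier G" using A that by blast
    then show ?thesis using x y by (simp add: group_word_simps)
  qed
  ultimately show ?thesis
    using A x y by (simp add: conj_subgroup_eq_image image_image cong: image_cong_simp)
qed

lemma trivial_conj_subgroup [simp]: "x \<in> carrier G \<Longrightarrow> conj_subgroup G x {\<one>} = {\<one>}"
  by (simp add: conj_subgroup_eq_image)

end

locale free_group_injection = free_group +
  fixes \<phi> :: "'a \<Rightarrow> 'a"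
  assumes finite_basis: "finite S"
    and hom_\<phi>: "\<phi> \<in> hom G G"
    and inj_\<phi>: "inj_on \<phi> (carrier G)"
begin

lemma \<phi>_closed [simp]: "x \<in> carrier G \<Longrightarrow> \<phi> x \<in> carrier G"
  and \<phi>_mult [simp]: "x \<in> carrier G \<Longrightarrow> y \<in> carrier G \<Longrightarrow> \<phi> (x \<otimes> y) = \<phi> x \<otimes> \<phi> y"
  using hom_\<phi> by (auto simp: hom_def)

lemma \<phi>_image_subset: "A \<subseteq> carrier G \<Longrightarrow> \<phi> ` A \<subseteq> carrier G"
  by auto

lemma funpow_hom: "\<phi> ^^ n \<in> hom G G"
  by (induction n) (auto simp: hom_def Pi_iff)

lemma funpow_closed [simp]: "x \<in> carrier G \<Longrightarrow> (\<phi> ^^ n) x \<in> carrier G"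
  using funpow_hom by (auto simp: hom_def)

lemma funpow_inj: "inj_on (\<phi> ^^ n) (carrier G)"
proof (induction n)
  case (Suc n)
  have "inj_on \<phi> ((\<phi> ^^ n) ` carrier G)" using inj_\<phi> by (rule inj_on_subset) auto
  then show ?case using comp_inj_on [OF Suc.IH] by (simp add: comp_def)
qed simp

section \<open>Iterated images, points of the inverse limit and their stabilizers\<close>

definition iterated_image :: "nat \<Rightarrow> 'a set" where
  "iterated_image n = (\<phi> ^^ n) ` carrier G"

abbreviation "H \<equiv> iterated_image"

lemma H_0: "H 0 = carrier G"
  and H_Suc: "H (Suc n) = \<phi> ` H n"
  by (simp_all add: iterated_image_def image_comp)

lemma H_Suc_subset: "H (Suc n) \<subseteq> H n"
  by (auto simp: iterated_image_def funpow_swap1)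

lemma H_antimono: "m \<le> n \<Longrightarrow> H n \<subseteq> H m"
  using H_Suc_subset by (rule lift_Suc_antimono_le)

lemma subgroup_H: "subgroup (H n) G"
proof -
  interpret group_hom G G "\<phi> ^^ n"
    using funpow_hom by (simp add: group_hom_def group_hom_axioms_def is_group)
  show ?thesis unfolding iterated_image_def by (rule img_is_subgroup)
qed

lemma H_closed: "H n \<subseteq> carrier G"
  using subgroup_H by (rule subgroup.subset)

lemma \<phi>_image_l_coset: "A \<subseteq> carrier G \<Longrightarrow> x \<in> carrier G \<Longrightarrow> \<phi> ` (x <# A) = \<phi> x <# \<phi> ` A"
  by (force simp: l_coset_def subset_iff)

text \<open>Left cosets are used because the group acts by left translation; inversion turns them
  into the right cosets that are the vertices of the Schreier graphs.\<close>

definition point :: "(nat \<Rightarrow> 'a set) \<Rightarrow> bool" where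
  "point C \<longleftrightarrow> (\<forall>n. (\<exists>x\<in>carrier G. C n = x <# H n) \<and> C (Suc n) \<subseteq> C n)"

definition translate :: "'a \<Rightarrow> (nat \<Rightarrow> 'a set) \<Rightarrow> nat \<Rightarrow> 'a set" where
  "translate f C n = f <# C n"

definition stab :: "(nat \<Rightarrow> 'a set) \<Rightarrow> 'a set" where
  "stab C = {f \<in> carrier G. translate f C = C}"

text \<open>Applying \<open>\<phi>\<close> raises the level by one because it maps
  \<open>H n\<close> onto \<open>H (Suc n)\<close>; level 0 is filled with the only coset
  there.\<close>

definition shift :: "(nat \<Rightarrow> 'a set) \<Rightarrow> nat \<Rightarrow> 'a set" where
  "shift C n = (case n of 0 \<Rightarrow> carrier G | Suc m \<Rightarrow> \<phi> ` C m)"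

lemma pointE:
  assumes "point C"
  obtains x where "x \<in> carrier G" "C n = x <# H n"
  using assms unfolding point_def by blast

lemma point_l_coset:
  assumes "point C" "x \<in> C n"
  shows "x \<in> carrier G \<and> C n = x <# H n"
proof -
  obtain y where y: "y \<in> carrier G" "C n = y <# H n" using assms pointE by blast
  then show ?thesis
    using assms l_repr_independence [OF _ y(1) subgroup_H] H_closed by (auto simp: mem_l_coset_iff)
qed

lemma point_nonempty: "point C \<Longrightarrow> \<exists>x. x \<in> C n"
  using subgroup_H H_closed unfolding point_def
  by (metis l_coset_eq_iff mem_l_coset_iff)

lemma point_closed: "point C \<Longrightarrow> C n \<subseteq> carrier G"
  using point_l_coset by blast

lemma point_antimono: "point C \<Longrightarrow> m \<le> n \<Longrightarrow> C n \<subseteq> C m"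
  by (rule lift_Suc_antimono_le) (auto simp: point_def)

text \<open>An element of the common coset at level \<open>n\<close> also determines the coset at
  every smaller level. Contrapositively, points separated at one level stay separated at all deeper
  ones.\<close>

lemma point_eq_antimono:
  assumes "point C" "point D" "C n = D n" "m \<le> n"
  shows "C m = D m"
proof -
  obtain x where "x \<in> C n" using point_nonempty assms by blast
  then have "x \<in> C m" "x \<in> D m" using assms point_antimono by blast+
  then show ?thesis using point_l_coset assms by metis
qed

lemma point_H: "point H"
  using H_Suc_subset H_closed by (auto simp: point_def lcos_mult_one intro!: bexI [of _ \<one>])

lemma point_translate:
  assumes "point C" "f \<in> carrier G"
  shows "point (translate f C)"
proof -
  have "\<exists>y\<in>carrier G. f <# C n = y <# H n" for n
  proof -
    obtain x where "x \<in> carrier G" "C n = x <# H n" using assms pointE by blast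
    then show ?thesis using assms H_closed by (intro bexI [of _ "f \<otimes> x"]) (auto simp: lcos_m_assoc)
  qed
  moreover have "f <# C (Suc n) \<subseteq> f <# C n" for n
    using point_antimono [OF assms(1), of n "Suc n"] by (auto simp: l_coset_def)
  ultimately show ?thesis by (simp add: point_def translate_def)
qed

lemma translate_translate:
  "point C \<Longrightarrow> f \<in> carrier G \<Longrightarrow> g \<in> carrier G \<Longrightarrow> translate f (translate g C) = translate (f \<otimes> g) C"
  using point_closed by (simp add: translate_def fun_eq_iff lcos_m_assoc)

lemma translate_one [simp]: "point C \<Longrightarrow> translate \<one> C = C"
  using point_closed by (simp add: translate_def fun_eq_iff lcos_mult_one)

lemma translate_eqD:
  assumes "point C" "point D" "f \<in> carrier G" "C = translate f D"
  shows "D = translate (inv f) C"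
  using assms by (simp add: translate_translate)

lemma stab_closed: "stab C \<subseteq> carrier G"
  by (auto simp: stab_def)

lemma subgroup_stab:
  assumes "point C"
  shows "subgroup (stab C) G"
proof (rule subgroupI)
  show "stab C \<noteq> {}" using assms by (auto simp: stab_def intro!: exI [of _ \<one>])
  fix f assume "f \<in> stab C"
  then show "inv f \<in> stab C" using assms translate_eqD [of C C f] by (auto simp: stab_def)
next
  fix f g assume "f \<in> stab C" "g \<in> stab C"
  then show "f \<otimes> g \<in> stab C" using assms by (auto simp: stab_def simp flip: translate_translate)
qed (rule stab_closed)

lemma stab_translate:
  assumes "point C" "f \<in> carrier G"
  shows "stab (translate f C) = conj_subgroup G f (stab C)"
proof -
  have "translate g (translate f C) = translate f C \<longleftrightarrow> translate (inv f \<otimes> g \<otimes> f) C = C"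
    if "g \<in> carrier G" for g
  proof -
    have "translate g (translate f C) = translate f (translate (inv f \<otimes> g \<otimes> f) C)"
      using assms that by (simp add: translate_translate group_word_simps)
    moreover have "translate f D = translate f C \<longleftrightarrow> D = C" if "point D" for D
      using assms that by (metis inv_closed l_inv translate_one translate_translate)
    ultimately show ?thesis using assms that by (simp add: point_translate)
  qed
  then show ?thesis
    using assms by (auto simp: mem_conj_subgroup_iff stab_closed) (auto simp: stab_def)
qed

lemma stab_conj_mem:
  assumes C: "point C" and g: "g \<in> stab C" and x: "x \<in> C n"
  shows "inv x \<otimes> g \<otimes> x \<in> H n"
proof -
  have xc: "x \<in> carrier G" "C n = x <# H n" using point_l_coset C x by auto
  have gc: "g \<in> carrier G" "translate g C = C" using g by (auto simp: stab_def)
  then have "g <# C n = C n" by (metis translate_def)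
  then have "g <# (x <# H n) = x <# H n" by (simp only: xc(2))
  then have "x <# H n = (g \<otimes> x) <# H n" using xc(1) gc H_closed by (simp add: lcos_m_assoc)
  then show ?thesis using xc gc subgroup_H by (simp add: l_coset_eq_iff m_assoc)
qed

lemma stabI:
  assumes C: "point C" and g: "g \<in> carrier G" and conj: "\<And>n. \<exists>x\<in>C n. inv x \<otimes> g \<otimes> x \<in> H n"
  shows "g \<in> stab C"
proof -
  have "g <# C n = C n" for n
  proof -
    obtain x where x: "x \<in> C n" "inv x \<otimes> g \<otimes> x \<in> H n" using conj by blast
    have xc: "x \<in> carrier G" "C n = x <# H n" using point_l_coset C x by auto
    have "x <# H n = (g \<otimes> x) <# H n" using x xc(1) g subgroup_H by (simp add: l_coset_eq_iff m_assoc)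
    also have "\<dots> = g <# (x <# H n)" using xc(1) g H_closed by (simp add: lcos_m_assoc)
    finally show ?thesis by (simp only: xc(2))
  qed
  then show ?thesis using g by (simp add: stab_def translate_def fun_eq_iff)
qed

section \<open>The map induced by \<phi> on the points\<close>

lemma point_shift:
  assumes "point C"
  shows "point (shift C)"
proof -
  have "\<exists>y\<in>carrier G. shift C n = y <# H n" for n
  proof (cases n)
    case 0
    then have "shift C n = \<one> <# H n" using H_0 by (simp add: shift_def lcos_mult_one)
    then show ?thesis by blast
  next
    case (Suc m)
    obtain x where "x \<in> carrier G" "C m = x <# H m" using assms pointE by blast
    then have "shift C n = \<phi> x <# H n" "\<phi> x \<in> carrier G"
      using Suc H_closed by (simp_all add: shift_def \<phi>_image_l_coset H_Suc)
    then show ?thesis by blast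
  qed
  moreover have "shift C (Suc n) \<subseteq> shift C n" for n
  proof (cases n)
    case 0
    then show ?thesis using point_closed [OF assms, of 0] by (auto simp: shift_def)
  next
    case (Suc m)
    then show ?thesis using point_antimono [OF assms, of m "Suc m"] by (auto simp: shift_def)
  qed
  ultimately show ?thesis by (simp add: point_def)
qed

lemma shift_translate:
  assumes "point C" "f \<in> carrier G"
  shows "shift (translate f C) = translate (\<phi> f) (shift C)"
proof
  fix n
  have "\<phi> f <# carrier G = carrier G" using assms coset_join3 subgroup_self by simp
  then show "shift (translate f C) n = translate (\<phi> f) (shift C) n"
    using assms point_closed [OF assms(1)]
    by (auto simp: shift_def translate_def \<phi>_image_l_coset split: nat.split)
qed

lemma shift_inj:
  assumes "point C" "point D" "shift C = shift D"
  shows "C = D"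
proof
  fix n
  have "\<phi> ` C n = \<phi> ` D n" using fun_cong [OF assms(3), of "Suc n"] by (simp add: shift_def)
  then show "C n = D n" using inj_\<phi> assms point_closed by (simp add: inj_on_image_eq_iff)
qed

text \<open>Both shifts have component \<open>H 1\<close> at level 1, so \<open>f\<close> lies in
  \<open>H 1\<close>, the image of \<open>\<phi>\<close>, and injectivity of the shift does the
  rest. Hence the shift is injective on orbits.\<close>

lemma shift_eq_translateD:
  assumes "point C" "point D" "f \<in> carrier G" "shift C = translate f (shift D)"
  shows "\<exists>g\<in>carrier G. f = \<phi> g \<and> C = translate g D"
proof -
  have one: "shift E 1 = H 1" if "point E" for E
  proof -
    have "E 0 = carrier G"
    proof -
      have "\<exists>x\<in>carrier G. E 0 = x <# H 0" using that pointE by blast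
      then obtain x where "x \<in> carrier G" "E 0 = x <# carrier G" using H_0 by auto
      then show ?thesis using coset_join3 subgroup_self by simp
    qed
    then show ?thesis using H_Suc [of 0] H_0 by (simp add: shift_def)
  qed
  have "H 1 = f <# H 1"
    using fun_cong [OF assms(4), of 1] one [OF assms(1)] one [OF assms(2)] by (simp add: translate_def)
  then have "\<one> <# H 1 = f <# H 1" using H_closed by (simp add: lcos_mult_one)
  then have "f \<in> H 1" using assms subgroup_H by (simp add: l_coset_eq_iff)
  then obtain g where g: "g \<in> carrier G" "f = \<phi> g" using H_Suc [of 0] H_0 by auto
  then have "shift C = shift (translate g D)"
    by (simp only: assms(4) shift_translate [OF assms(2)])
  then have "C = translate g D" using shift_inj [OF assms(1) point_translate [OF assms(2) g(1)]] by blast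
  then show ?thesis using g by blast
qed

lemma stab_shift:
  assumes "point C"
  shows "stab (shift C) = \<phi> ` stab C"
proof (intro equalityI subsetI)
  fix f assume "f \<in> stab (shift C)"
  then have "f \<in> carrier G" "shift C = translate f (shift C)" by (auto simp: stab_def)
  then obtain g where "g \<in> carrier G" "f = \<phi> g" "C = translate g C"
    using shift_eq_translateD assms by blast
  then show "f \<in> \<phi> ` stab C" by (auto simp: stab_def)
next
  fix f assume "f \<in> \<phi> ` stab C"
  then obtain g where g: "g \<in> carrier G" "f = \<phi> g" "translate g C = C" by (auto simp: stab_def)
  then have "translate (\<phi> g) (shift C) = shift C"
    using assms by (simp flip: shift_translate)
  then show "f \<in> stab (shift C)" using g by (simp add: stab_def)
qed

text \<open>From level 1 on, all components lie in the image of \<open>\<phi>\<close> and can be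
  pulled back one by one.\<close>

lemma shift_surj:
  assumes D: "point D" "D 1 = H 1"
  shows "\<exists>C. point C \<and> shift C = D"
proof -
  define C where "C n = {x \<in> carrier G. \<phi> x \<in> D (Suc n)}" for n
  have D0: "D 0 = H 0" using point_eq_antimono [OF D(1) point_H D(2)] by simp
  have sub: "D (Suc n) \<subseteq> \<phi> ` carrier G" for n
    using point_antimono [OF D(1), of 1 "Suc n"] D(2) H_Suc [of 0] H_0 by simp
  then have img: "\<phi> ` C n = D (Suc n)" for n
    unfolding C_def by (rule image_Collect_mem)
  have "\<exists>x\<in>carrier G. C n = x <# H n" for n
  proof -
    obtain y where y: "y \<in> D (Suc n)" using point_nonempty D by blast
    then obtain x where x: "x \<in> carrier G" "y = \<phi> x" using sub by blast
    have "\<phi> ` C n = \<phi> ` (x <# H n)"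
      using img point_l_coset [OF D(1) y] x H_closed by (simp add: \<phi>_image_l_coset H_Suc)
    moreover have "C n \<subseteq> carrier G" "x <# H n \<subseteq> carrier G"
      using x H_closed l_coset_subset_G by (auto simp: C_def)
    ultimately have "C n = x <# H n" using inj_\<phi> by (simp add: inj_on_image_eq_iff)
    then show ?thesis using x by blast
  qed
  moreover have "C (Suc n) \<subseteq> C n" for n
    using D(1) by (auto simp: C_def point_def)
  ultimately have "point C" by (simp add: point_def)
  moreover have "shift C = D"
    using img D0 H_0 by (auto simp: shift_def fun_eq_iff split: nat.split)
  ultimately show ?thesis by blast
qed

lemma point_funpow_shift: "point C \<Longrightarrow> point ((shift ^^ n) C)"
  by (induction n) (auto simp: point_shift)

lemma funpow_shift_surj:
  assumes "point D" "D n = H n"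
  shows "\<exists>C. point C \<and> (shift ^^ n) C = D"
  using assms
proof (induction n arbitrary: D)
  case (Suc n)
  have "D 1 = H 1" using point_eq_antimono [OF Suc.prems(1) point_H Suc.prems(2), of 1] by simp
  then obtain C where C: "point C" "shift C = D" using shift_surj Suc.prems by blast
  have "\<phi> ` C n = \<phi> ` H n" using C(2) Suc.prems(2) H_Suc by (auto simp: shift_def)
  then have "C n = H n" using inj_\<phi> C point_closed H_closed by (simp add: inj_on_image_eq_iff)
  then show ?case using Suc.IH [OF C(1)] C by auto
qed auto

lemma stab_funpow_shift: "point C \<Longrightarrow> stab ((shift ^^ n) C) = (\<phi> ^^ n) ` stab C"
  by (induction n) (auto simp: point_funpow_shift stab_shift)

lemma funpow_shift_eq_translateD:
  assumes "point C" "point D" "f \<in> carrier G" "(shift ^^ n) C = translate f ((shift ^^ n) D)"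
  shows "\<exists>g\<in>carrier G. C = translate g D"
  using assms
proof (induction n arbitrary: f)
  case (Suc n)
  then obtain g where "g \<in> carrier G" "(shift ^^ n) C = translate g ((shift ^^ n) D)"
    using shift_eq_translateD [of "(shift ^^ n) C" "(shift ^^ n) D" f] by (auto simp: point_funpow_shift)
  then show ?case using Suc by blast
qed auto

section \<open>Finiteness of fixed cosets and existence of fixed points\<close>

lemma exists_schreier_domain_single:
  assumes "subgroup K G"
  shows "\<exists>Q. schreier_domain G S K Q"
  using exists_schreier_domain [OF assms, of "{}" "\<lambda>_. \<one>" "\<lambda>_. {}"] by auto

text \<open>Passing from \<open>x\<close> to the vertex of a Schreier transversal in the right coset
  of \<open>inv x\<close> reduces this to \<open>finite_fixed_cosets\<close>, which applies because
  \<open>H n\<close> has finitely many leaving edges.\<close>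

lemma finite_fixed_l_cosets:
  assumes g: "g \<in> carrier G" "g \<noteq> \<one>"
  shows "finite {x <# H n | x. x \<in> carrier G \<and> inv x \<otimes> g \<otimes> x \<in> H n}"
proof -
  obtain Q where "schreier_domain G S (H n) Q" using exists_schreier_domain_single subgroup_H by blast
  then interpret Q: schreier_domain G S "H n" Q .
  have "finite Q.leaving_edges"
    using Q.leaving_edges_finite [OF finite_basis funpow_hom funpow_inj] iterated_image_def by blast
  then have fin: "finite {q \<in> Q. q \<otimes> g \<otimes> inv q \<in> H n}" using Q.finite_fixed_cosets g by blast
  have "x <# H n \<in> (\<lambda>q. inv q <# H n) ` {q \<in> Q. q \<otimes> g \<otimes> inv q \<in> H n}"
    if x: "x \<in> carrier G" "inv x \<otimes> g \<otimes> x \<in> H n" for x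
  proof -
    obtain q where q: "q \<in> Q" "same_coset (H n) (inv x) q" using Q.coset_exists [of "inv x"] x by auto
    let ?h = "inv x \<otimes> inv q"
    have qc: "q \<in> carrier G" using q Q.Q_closed by blast
    have h: "?h \<in> H n" "inv ?h \<in> H n"
      using q subgroup_H by (auto simp: same_coset_def subgroup.m_inv_closed)
    have "inv ?h \<otimes> (inv x \<otimes> g \<otimes> x) \<otimes> ?h \<in> H n"
      using h x subgroup_H by (meson subgroup.m_closed)
    then have "q \<otimes> g \<otimes> inv q \<in> H n" using x qc g by (simp add: group_word_simps)
    moreover have "x <# H n = inv q <# H n" using h x qc subgroup_H by (simp add: l_coset_eq_iff)
    ultimately show ?thesis using q by blast
  qed
  then have "{x <# H n | x. x \<in> carrier G \<and> inv x \<otimes> g \<otimes> x \<in> H n}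
      \<subseteq> (\<lambda>q. inv q <# H n) ` {q \<in> Q. q \<otimes> g \<otimes> inv q \<in> H n}" by blast
  then show ?thesis using fin finite_subset by blast
qed

text \<open>Koenig's lemma: at each level only finitely many cosets are fixed by \<open>B\<close>.\<close>

lemma tail_fixes_point:
  assumes B: "B \<subseteq> carrier G" "g \<in> B" "g \<noteq> \<one>"
    and tail: "\<And>n. \<exists>x\<in>carrier G. B \<subseteq> conj_subgroup G x (H n)"
  shows "\<exists>C. point C \<and> B \<subseteq> stab C"
proof -
  define W where "W n = {x <# H n | x. x \<in> carrier G \<and> (\<forall>b\<in>B. inv x \<otimes> b \<otimes> x \<in> H n)}" for n
  \<comment> \<open>\<open>W n\<close> holds the cosets fixed by all of \<open>B\<close>, finitely
    many since already \<open>g\<close> fixes only finitely many. \<open>P\<close> is the usual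
    invariant of an infinite branch: there are descendants at every deeper level.\<close>
  define P where "P n D \<longleftrightarrow> D \<in> W n \<and> (\<forall>m\<ge>n. \<exists>E\<in>W m. E \<subseteq> D)" for n D
  have W_sub: "W n \<subseteq> {x <# H n | x. x \<in> carrier G \<and> inv x \<otimes> g \<otimes> x \<in> H n}" for n
    using B(2) by (auto simp: W_def)
  have gc: "g \<in> carrier G" using B by blast
  have finW: "finite (W n)" for n
    by (rule finite_subset [OF W_sub finite_fixed_l_cosets [OF gc B(3)]])
  have neW: "\<exists>E. E \<in> W n" for n
  proof -
    obtain x where x: "x \<in> carrier G" "B \<subseteq> conj_subgroup G x (H n)" using tail by blast
    then show ?thesis using H_closed by (auto simp: W_def subset_iff mem_conj_subgroup_iff)
  qed
  have lower: "x <# H n \<in> W n \<and> x <# H m \<subseteq> x <# H n"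
    if "x \<in> carrier G" "\<forall>b\<in>B. inv x \<otimes> b \<otimes> x \<in> H m" "n \<le> m" for x m n
    using that H_antimono [OF that(3)] unfolding W_def l_coset_def by blast
  have self: "x \<in> x <# H n" if "x \<in> carrier G" for x n
    using that H_closed subgroup_H by (simp add: mem_l_coset_iff subgroup.one_closed)
  have base: "\<exists>D. P 0 D"
  proof -
    have "carrier G \<in> W 0"
    proof -
      have "\<one> <# H 0 = carrier G" using H_0 by (simp add: lcos_mult_one)
      then show ?thesis using B H_0 unfolding W_def by force
    qed
    moreover have "E \<subseteq> carrier G" if "E \<in> W m" for E m
      using that l_coset_subset_G [OF H_closed] unfolding W_def by blast
    ultimately have "P 0 (carrier G)" using neW by (auto simp: P_def)
    then show ?thesis by blast
  qed
  have step: "\<exists>D'. P (Suc n) D' \<and> D' \<subseteq> D" if D: "P n D" for n D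
  proof (rule ccontr)
    assume "\<not> (\<exists>D'. P (Suc n) D' \<and> D' \<subseteq> D)"
    then have "\<forall>D'\<in>W (Suc n). D' \<subseteq> D \<longrightarrow> (\<exists>m\<ge>Suc n. \<not> (\<exists>E\<in>W m. E \<subseteq> D'))"
      by (auto simp: P_def)
    then obtain k where k: "\<And>D'. D' \<in> W (Suc n) \<Longrightarrow> D' \<subseteq> D \<Longrightarrow> Suc n \<le> k D' \<and> \<not> (\<exists>E\<in>W (k D'). E \<subseteq> D')"
      by metis
    \<comment> \<open>Level \<open>m\<close> is at least as deep as every level at which a child of
      \<open>D\<close> has died out, so a descendant of \<open>D\<close> at level \<open>m\<close>
      passes through a child that is already dead.\<close>
    define m where "m = Max (insert (Suc n) (k ` W (Suc n)))"
    have m: "Suc n \<le> m" "\<And>D'. D' \<in> W (Suc n) \<Longrightarrow> k D' \<le> m"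
      using finW by (auto simp: m_def)
    then obtain E where "E \<in> W m" "E \<subseteq> D" using D unfolding P_def by (meson Suc_leD)
    then obtain x where x: "x \<in> carrier G" "x <# H m \<subseteq> D" "\<forall>b\<in>B. inv x \<otimes> b \<otimes> x \<in> H m"
      by (auto simp: W_def)
    have "D = x <# H n"
    proof -
      obtain y where y: "y \<in> carrier G" "D = y <# H n" using D by (auto simp: P_def W_def)
      then have "x \<in> y <# H n" using x self by blast
      then show ?thesis using y l_repr_independence subgroup_H by metis
    qed
    then have "x <# H (Suc n) \<subseteq> D" using H_Suc_subset by (auto simp: l_coset_def)
    moreover have "x <# H (Suc n) \<in> W (Suc n)" using lower x m by blast
    ultimately have "Suc n \<le> k (x <# H (Suc n))" "k (x <# H (Suc n)) \<le> m"
      "\<not> (\<exists>E\<in>W (k (x <# H (Suc n))). E \<subseteq> x <# H (Suc n))"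
      using k m by auto
    moreover from this have "x <# H (k (x <# H (Suc n))) \<in> W (k (x <# H (Suc n)))"
      using lower x by blast
    moreover have "x <# H (k (x <# H (Suc n))) \<subseteq> x <# H (Suc n)"
      using H_antimono calculation(1) unfolding l_coset_def by blast
    ultimately show False by blast
  qed
  have "\<exists>C. \<forall>n. P n (C n) \<and> C (Suc n) \<subseteq> C n"
    by (rule dependent_nat_choice [of P "\<lambda>n D D'. D' \<subseteq> D"]) (fact base, fact step)
  then obtain C where C: "\<And>n. P n (C n)" "\<And>n. C (Suc n) \<subseteq> C n" by blast
  have CW: "C n \<in> W n" for n using C(1) by (simp add: P_def)
  then have "point C" using C(2) by (fastforce simp: point_def W_def)
  moreover have "b \<in> stab C" if b: "b \<in> B" for b
  proof (rule stabI [OF \<open>point C\<close>])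
    show "b \<in> carrier G" using B b by blast
    fix n
    obtain x where "x \<in> carrier G" "C n = x <# H n" "\<forall>b\<in>B. inv x \<otimes> b \<otimes> x \<in> H n"
      using CW [of n] by (auto simp: W_def)
    then show "\<exists>x\<in>C n. inv x \<otimes> b \<otimes> x \<in> H n" using self b by blast
  qed
  ultimately show ?thesis by blast
qed

end

section \<open>Representatives of the points with nontrivial stabilizer\<close>

context free_group_injection
begin

text \<open>Translation by \<open>c\<close> conjugates the stabilizer by \<open>c\<close>, and
  whatever fixes the translated point fixes its component \<open>H n\<close>, a coset whose
  stabilizer is \<open>H n\<close>.\<close>

lemma conj_stab_in_H:
  assumes C: "point C" and c: "c \<in> carrier G" "translate c C n = H n" and m: "m \<in> stab C"
  shows "c \<otimes> m \<otimes> inv c \<in> H n"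
proof -
  have mc: "m \<in> carrier G" using m stab_closed by blast
  have "c \<otimes> m \<otimes> inv c \<in> stab (translate c C)"
    using C c m mc by (simp add: stab_translate mem_conj_subgroup_iff stab_closed group_word_simps)
  moreover have "\<one> \<in> translate c C n" using c subgroup_H by (simp add: subgroup.one_closed)
  ultimately have "inv \<one> \<otimes> (c \<otimes> m \<otimes> inv c) \<otimes> \<one> \<in> H n"
    using stab_conj_mem point_translate C c by blast
  then show ?thesis using c mc by simp
qed

text \<open>Two distinct points of the inverse limit are separated at all sufficiently deep levels. Hence
  a finite part of the Schreier graphs of the stabilizers embeds in the Schreier graph of \<open>H n\<close>.\<close>

lemma embed_in_level:
  assumes fin: "finite I" and pt: "\<And>C. C \<in> I \<Longrightarrow> point C"
    and ineq: "\<And>C D f. C \<in> I \<Longrightarrow> D \<in> I \<Longrightarrow> f \<in> carrier G \<Longrightarrow> C = translate f D \<Longrightarrow> C = D"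
    and R: "\<And>C. C \<in> I \<Longrightarrow> schreier_domain G S (stab C) (R C)"
    and P: "\<And>C. C \<in> I \<Longrightarrow> finite (P C) \<and> convex (P C) \<and> P C \<subseteq> R C"
  shows "\<exists>n Q c. schreier_domain G S (H n) Q \<and>
    (\<forall>C\<in>I. c C \<in> carrier G \<and> translate (c C) C n = H n \<and> (\<lambda>u. c C \<otimes> u) ` P C \<subseteq> Q) \<and>
    (\<forall>C\<in>I. \<forall>D\<in>I. \<forall>u\<in>P C. \<forall>v\<in>P D. c C \<otimes> u = c D \<otimes> v \<longrightarrow> C = D \<and> u = v)"
proof -
  have Pc: "u \<in> carrier G" if "C \<in> I" "u \<in> P C" for C u using P that convex_subset by blast
  \<comment> \<open>Vertex \<open>u\<close> of the Schreier graph of \<open>stab C\<close> stands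
    for the point \<open>translate (inv u) C\<close>. Two vertices with the same point force
    \<open>C = D\<close> by inequivalence, and then \<open>u = v\<close> because both lie in one
    transversal.\<close>
  have "\<exists>n. translate (inv u) C n \<noteq> translate (inv v) D n"
    if "C \<in> I" "D \<in> I" "u \<in> P C" "v \<in> P D" "(C, u) \<noteq> (D, v)" for C D u v
  proof (rule ccontr)
    assume "\<nexists>n. translate (inv u) C n \<noteq> translate (inv v) D n"
    then have "translate (inv u) C = translate (inv v) D" by blast
    then have "translate u (translate (inv u) C) = translate u (translate (inv v) D)" by simp
    then have eq: "C = translate (u \<otimes> inv v) D" using pt that Pc by (simp add: translate_translate)
    then have "C = D" using ineq [OF that(1,2) _ eq] Pc [OF that(1,3)] Pc [OF that(2,4)] by simp
    then have "same_coset (stab C) u v" using eq that Pc by (simp add: same_coset_def stab_def)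
    then have "u = v"
      using schreier_domain.coset_unique [OF R] P that \<open>C = D\<close> by blast
    then show False using that \<open>C = D\<close> by simp
  qed
  then have "\<forall>p\<in>Sigma I P \<times> Sigma I P. \<exists>n. fst p \<noteq> snd p \<longrightarrow>
      translate (inv (snd (fst p))) (fst (fst p)) n \<noteq> translate (inv (snd (snd p))) (fst (snd p)) n"
    by auto
  then obtain d where d: "\<And>p. p \<in> Sigma I P \<times> Sigma I P \<Longrightarrow> fst p \<noteq> snd p \<Longrightarrow>
      translate (inv (snd (fst p))) (fst (fst p)) (d p) \<noteq> translate (inv (snd (snd p))) (fst (snd p)) (d p)"
    by metis
  \<comment> \<open>Only finitely many pairs have to be separated, and separation persists at deeper
    levels.\<close>
  define n where "n = Max (insert 0 (d ` (Sigma I P \<times> Sigma I P)))"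
  have dn: "d p \<le> n" if "p \<in> Sigma I P \<times> Sigma I P" for p
    using that fin P by (auto simp: n_def)
  have sep: "C = D \<and> u = v"
    if "C \<in> I" "D \<in> I" "u \<in> P C" "v \<in> P D" "translate (inv u) C n = translate (inv v) D n" for C D u v
  proof (rule ccontr)
    assume "\<not> (C = D \<and> u = v)"
    moreover have "translate (inv u) C (d ((C, u), (D, v))) = translate (inv v) D (d ((C, u), (D, v)))"
      by (rule point_eq_antimono [OF point_translate [OF pt [OF that(1)] inv_closed [OF Pc [OF that(1,3)]]]
            point_translate [OF pt [OF that(2)] inv_closed [OF Pc [OF that(2,4)]]] that(5) dn])
        (use that in auto)
    ultimately show False using d [of "((C, u), (D, v))"] that by auto
  qed
  have "\<forall>C\<in>I. \<exists>x. x \<in> C n" using point_nonempty pt by blast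
  \<comment> \<open>At level \<open>n\<close>, the vertex \<open>u\<close> of the piece of
    \<open>C\<close> becomes the right coset of \<open>inv (x C) \<otimes> u\<close>, whatever
    element of \<open>C n\<close> is chosen as \<open>x C\<close>.\<close>
  then obtain x where x: "\<And>C. C \<in> I \<Longrightarrow> x C \<in> C n" by metis
  have xc: "x C \<in> carrier G" "C n = x C <# H n" if "C \<in> I" for C
    using point_l_coset [of C "x C" n] pt x that by blast+
  have inj: "C = D \<and> u = v"
    if CD: "C \<in> I" "D \<in> I" "u \<in> P C" "v \<in> P D" and
      sc: "same_coset (H n) (inv (x C) \<otimes> u) (inv (x D) \<otimes> v)" for C D u v
  proof (rule sep [OF CD])
    have "(inv u \<otimes> x C) <# H n = (inv v \<otimes> x D) <# H n"
      using sc CD xc(1) Pc subgroup_H by (simp add: l_coset_eq_iff same_coset_def group_word_simps)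
    then have "inv u <# (x C <# H n) = inv v <# (x D <# H n)"
      using CD xc(1) Pc H_closed by (simp add: lcos_m_assoc)
    then show "translate (inv u) C n = translate (inv v) D n"
      using xc(2) CD by (metis translate_def)
  qed
  obtain Q where Q: "schreier_domain G S (H n) Q"
    "\<forall>C\<in>I. \<exists>h\<in>H n. (\<lambda>u. h \<otimes> inv (x C) \<otimes> u) ` P C \<subseteq> Q"
    using exists_schreier_domain [OF subgroup_H, of I "\<lambda>C. inv (x C)" P n] xc(1) P inj by blast
  then obtain h where h: "\<And>C. C \<in> I \<Longrightarrow> h C \<in> H n \<and> (\<lambda>u. h C \<otimes> inv (x C) \<otimes> u) ` P C \<subseteq> Q"
    by metis
  have hc: "h C \<in> carrier G" if "C \<in> I" for C using h [OF that] H_closed by blast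
  \<comment> \<open>\<open>inv (x C)\<close> moves the component of \<open>C\<close> at level
    \<open>n\<close> to \<open>H n\<close>, and the factor \<open>h C\<close> from
    \<open>H n\<close> leaves it there.\<close>
  let ?c = "\<lambda>C. h C \<otimes> inv (x C)"
  have "translate (?c C) C n = H n" if C: "C \<in> I" for C
  proof -
    have "translate (?c C) C n = ?c C <# (x C <# H n)"
      using xc(2) [OF C] by (metis translate_def)
    also have "\<dots> = h C <# H n"
      using xc(1) [OF C] hc [OF C] H_closed by (simp add: lcos_m_assoc m_assoc)
    also have "\<dots> = H n" using h [OF C] hc [OF C] coset_join3 subgroup_H by blast
    finally show ?thesis .
  qed
  moreover have "C = D \<and> u = v"
    if CD: "C \<in> I" "D \<in> I" "u \<in> P C" "v \<in> P D" and eq: "?c C \<otimes> u = ?c D \<otimes> v" for C D u v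
  proof (rule inj [OF CD])
    have "same_coset (H n) (h E \<otimes> (inv (x E) \<otimes> w)) (inv (x E) \<otimes> w)" if "E \<in> I" "w \<in> P E" for E w
      using that same_coset_mult_left [OF subgroup_H] h xc(1) Pc by auto
    from this [OF CD(1,3)] this [OF CD(2,4)]
    show "same_coset (H n) (inv (x C) \<otimes> u) (inv (x D) \<otimes> v)"
      using eq CD xc(1) Pc hc by (simp add: same_coset_iff_r_coset [OF subgroup_H] m_assoc)
  qed
  ultimately show ?thesis
    using Q(1) h hc xc(1) by (intro exI [of _ n] exI [of _ Q] exI [of _ ?c]) auto
qed

text \<open>Finitely many edges, with the representatives of their ends, lie in finite subtrees of
  the transversals. Once these embed in one level \<open>n\<close>, the edges become distinct
  leaving edges for \<open>H n\<close>, of which there are at most \<open>card S\<close>.\<close>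

lemma card_edges_le:
  assumes fin: "finite I" and pt: "\<And>C. C \<in> I \<Longrightarrow> point C"
    and ineq: "\<And>C D f. C \<in> I \<Longrightarrow> D \<in> I \<Longrightarrow> f \<in> carrier G \<Longrightarrow> C = translate f D \<Longrightarrow> C = D"
    and R: "\<And>C. C \<in> I \<Longrightarrow> schreier_domain G S (stab C) (R C)"
    and Z: "finite Z" "Z \<subseteq> Sigma I (\<lambda>C. schreier_domain.leaving_edges G S (R C))"
  shows "card Z \<le> card S"
proof -
  define U where "U C = (\<lambda>(D, u, s). u) ` {z \<in> Z. fst z = C} \<union>
    (\<lambda>(D, u, s). schreier_domain.rep G (stab C) (R C) (u \<otimes> s)) ` {z \<in> Z. fst z = C}" for C
  have "\<exists>P. finite P \<and> convex P \<and> \<one> \<in> P \<and> U C \<subseteq> P \<and> P \<subseteq> R C" if C: "C \<in> I" for C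
  proof -
    interpret R: schreier_domain G S "stab C" "R C" by (rule R [OF C])
    have "u \<in> R C \<and> R.rep (u \<otimes> s) \<in> R C" if "(C, u, s) \<in> Z" for u s
    proof -
      have "(u, s) \<in> R.leaving_edges" using that Z by auto
      then show ?thesis using R.leaving_edge [of "(u, s)"] by simp
    qed
    then have "U C \<subseteq> R C" by (auto simp: U_def)
    then show ?thesis
      using convex_finite_superset [OF R.convex_Q R.one_Q, of "U C"] Z by (auto simp: U_def)
  qed
  then obtain P where P: "\<And>C. C \<in> I \<Longrightarrow> finite (P C) \<and> convex (P C) \<and> \<one> \<in> P C \<and> U C \<subseteq> P C \<and> P C \<subseteq> R C"
    by metis
  have UP: "u \<in> P C" "schreier_domain.rep G (stab C) (R C) (u \<otimes> s) \<in> P C"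
    if "(C, u, s) \<in> Z" for C u s
  proof -
    have "C \<in> I" using that Z by auto
    then have "U C \<subseteq> P C" using P by blast
    then show "u \<in> P C" "schreier_domain.rep G (stab C) (R C) (u \<otimes> s) \<in> P C"
      using that by (force simp: U_def)+
  qed
  have "\<exists>n Q c. schreier_domain G S (H n) Q \<and>
    (\<forall>C\<in>I. c C \<in> carrier G \<and> translate (c C) C n = H n \<and> (\<lambda>u. c C \<otimes> u) ` P C \<subseteq> Q) \<and>
    (\<forall>C\<in>I. \<forall>D\<in>I. \<forall>u\<in>P C. \<forall>v\<in>P D. c C \<otimes> u = c D \<otimes> v \<longrightarrow> C = D \<and> u = v)"
    by (rule embed_in_level [OF fin pt ineq R]) (use P in auto)
  then obtain n Q c where Q: "schreier_domain G S (H n) Q"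
    and c: "\<And>C. C \<in> I \<Longrightarrow> c C \<in> carrier G \<and> translate (c C) C n = H n \<and> (\<lambda>u. c C \<otimes> u) ` P C \<subseteq> Q"
    and inj: "\<And>C D u v. C \<in> I \<Longrightarrow> D \<in> I \<Longrightarrow> u \<in> P C \<Longrightarrow> v \<in> P D \<Longrightarrow> c C \<otimes> u = c D \<otimes> v \<Longrightarrow> C = D \<and> u = v"
    by metis
  interpret Q: schreier_domain G S "H n" Q by (rule Q)
  let ?f = "\<lambda>(C, u, s). (c C \<otimes> u, s)"
  have "inj_on ?f Z"
  proof (rule inj_onI)
    fix y z assume yz: "y \<in> Z" "z \<in> Z" "?f y = ?f z"
    obtain C u s D v t where y: "y = (C, u, s)" and z: "z = (D, v, t)" by (metis prod_cases3)
    have "C \<in> I" "D \<in> I" "u \<in> P C" "v \<in> P D" using yz y z Z UP by auto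
    then show "y = z" using inj yz y z by auto
  qed
  moreover have "?f ` Z \<subseteq> Q.leaving_edges"
  proof clarify
    fix C u s assume z: "(C, u, s) \<in> Z"
    then have C: "C \<in> I" and e: "(u, s) \<in> schreier_domain.leaving_edges G S (R C)" using Z by auto
    show "(c C \<otimes> u, s) \<in> Q.leaving_edges"
      using schreier_gen_conjugate [OF R [OF C] Q _ _ e, of "c C"] c [OF C] UP [OF z]
        conj_stab_in_H [OF pt [OF C]] by blast
  qed
  moreover have "finite Q.leaving_edges \<and> card Q.leaving_edges \<le> card S"
    using Q.leaving_edges_finite [OF finite_basis funpow_hom funpow_inj] iterated_image_def by blast
  ultimately show ?thesis by (meson card_inj_on_le le_trans)
qed

lemma translate_funpow_shift:
  "point C \<Longrightarrow> f \<in> carrier G \<Longrightarrow> (shift ^^ n) (translate f C) = translate ((\<phi> ^^ n) f) ((shift ^^ n) C)"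
  by (induction n) (auto simp: shift_translate point_funpow_shift)

definition inequivalent :: "(nat \<Rightarrow> 'a set) set \<Rightarrow> bool" where
  "inequivalent I \<longleftrightarrow> (\<forall>C\<in>I. \<forall>D\<in>I. \<forall>f\<in>carrier G. C = translate f D \<longrightarrow> C = D)"

lemma exists_representatives:
  "\<exists>J. finite J \<and> (\<forall>C\<in>J. point C \<and> stab C \<noteq> {\<one>}) \<and> inequivalent J \<and>
    (\<forall>D. point D \<longrightarrow> stab D \<noteq> {\<one>} \<longrightarrow> (\<exists>C\<in>J. \<exists>f\<in>carrier G. D = translate f C)) \<and>
    (J \<noteq> {} \<longrightarrow> inj_on stab J \<and> nontrivial_free_factor_system G (stab ` J))"
proof -
  have "\<forall>C. \<exists>Q. point C \<longrightarrow> schreier_domain G S (stab C) Q"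
    using exists_schreier_domain_single subgroup_stab by blast
  then obtain R where R: "\<And>C. point C \<Longrightarrow> schreier_domain G S (stab C) (R C)" by metis
  let ?E = "\<lambda>C. schreier_domain.leaving_edges G S (R C)"
  let ?gen = "\<lambda>C. schreier_domain.gen G (stab C) (R C)"
  have generate_stab: "generate G (?gen C ` ?E C) = stab C" if "point C" for C
    using schreier_domain.generate_gen [OF R [OF that]] .
  have ne: "?E C \<noteq> {}" if "point C" "stab C \<noteq> {\<one>}" for C
    using generate_stab [OF that(1)] that(2) generate_empty by (metis image_empty)
  define good where
    "good I \<longleftrightarrow> finite I \<and> (\<forall>C\<in>I. point C \<and> stab C \<noteq> {\<one>}) \<and> inequivalent I" for I
  have bound: "finite (Sigma I ?E) \<and> card (Sigma I ?E) \<le> card S" if I: "good I" for I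
  proof (rule finite_if_finite_subsets_card_bdd)
    fix Z assume "Z \<subseteq> Sigma I ?E" "finite Z"
    then show "card Z \<le> card S"
      using I R by (intro card_edges_le [of I R Z]) (auto simp: good_def inequivalent_def)
  qed
  \<comment> \<open>Every nontrivial stabilizer has at least one Schreier generator, so the bound on
    edges bounds the number of points.\<close>
  have "card I \<le> card S" if I: "good I" for I
  proof -
    have "C \<in> fst ` Sigma I ?E" if C: "C \<in> I" for C
    proof -
      have "?E C \<noteq> {}" using ne C I by (simp add: good_def)
      then obtain e where "e \<in> ?E C" by blast
      then show ?thesis using C by (intro image_eqI [of _ _ "(C, e)"]) auto
    qed
    then have "I \<subseteq> fst ` Sigma I ?E" by blast
    then have "card I \<le> card (Sigma I ?E)" using bound [OF I] by (meson card_image_le card_mono finite_imageI le_trans)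
    then show ?thesis using bound [OF I] by simp
  qed
  moreover have "good {}" by (simp add: good_def inequivalent_def)
  ultimately obtain I where I: "good I" and max: "\<And>I'. good I' \<Longrightarrow> card I' \<le> card I"
    using ex_has_greatest_nat [of good "{}" card "Suc (card S)"] le_imp_less_Suc by blast
  have Ip: "point C" "stab C \<noteq> {\<one>}" if "C \<in> I" for C using I that by (auto simp: good_def)
  have Iineq: "C = D" if "C \<in> I" "D \<in> I" "f \<in> carrier G" "C = translate f D" for C D f
    using I that by (auto simp: good_def inequivalent_def)
  have rep: "\<exists>C\<in>I. \<exists>f\<in>carrier G. D = translate f C" if D: "point D" "stab D \<noteq> {\<one>}" for D
  proof (rule ccontr)
    assume no: "\<not> ?thesis"
    have no': "C \<noteq> translate f D" if "C \<in> I" "f \<in> carrier G" for C f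
      using no translate_eqD [OF Ip(1) D(1), of C f] that by blast
    have "D \<notin> I"
    proof
      assume "D \<in> I"
      moreover have "D = translate \<one> D" using D by simp
      ultimately show False using no by blast
    qed
    moreover have "good (insert D I)"
      using I D no no' by (auto simp: good_def inequivalent_def)
    ultimately show False using max [of "insert D I"] I by (simp add: good_def)
  qed
  have finE: "finite (?E C)" if "C \<in> I" for C
  proof -
    have "Pair C ` ?E C \<subseteq> Sigma I ?E" using that by auto
    then have "finite (Pair C ` ?E C)" using bound [OF I] finite_subset by blast
    then show ?thesis by (rule finite_imageD) (auto simp: inj_on_def)
  qed
  \<comment> \<open>Starts of edges and representatives of their ends: with both in the piece,
    conjugation by \<open>c C\<close> turns Schreier generators of the stabilizer into Schreier
    generators of \<open>H n\<close>.\<close>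
  define U where
    "U C = fst ` ?E C \<union> (\<lambda>e. schreier_domain.rep G (stab C) (R C) (fst e \<otimes> snd e)) ` ?E C" for C
  have "\<exists>P. finite P \<and> convex P \<and> \<one> \<in> P \<and> U C \<subseteq> P \<and> P \<subseteq> R C" if C: "C \<in> I" for C
  proof -
    interpret R: schreier_domain G S "stab C" "R C" by (rule R [OF Ip(1) [OF C]])
    have "U C \<subseteq> R C" using R.leaving_edge by (auto simp: U_def)
    then show ?thesis
      using convex_finite_superset [OF R.convex_Q R.one_Q, of "U C"] finE [OF C] by (auto simp: U_def)
  qed
  then obtain P where P: "\<And>C. C \<in> I \<Longrightarrow> finite (P C) \<and> convex (P C) \<and> \<one> \<in> P C \<and> U C \<subseteq> P C \<and> P C \<subseteq> R C"
    by metis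
  have "\<exists>n Q c. schreier_domain G S (H n) Q \<and>
    (\<forall>C\<in>I. c C \<in> carrier G \<and> translate (c C) C n = H n \<and> (\<lambda>u. c C \<otimes> u) ` P C \<subseteq> Q) \<and>
    (\<forall>C\<in>I. \<forall>D\<in>I. \<forall>u\<in>P C. \<forall>v\<in>P D. c C \<otimes> u = c D \<otimes> v \<longrightarrow> C = D \<and> u = v)"
    by (rule embed_in_level [OF _ Ip(1) Iineq R [OF Ip(1)]]) (use P I in \<open>auto simp: good_def\<close>)
  then obtain n Q c where Q: "schreier_domain G S (H n) Q"
    and c: "\<And>C. C \<in> I \<Longrightarrow> c C \<in> carrier G \<and> translate (c C) C n = H n \<and> (\<lambda>u. c C \<otimes> u) ` P C \<subseteq> Q"
    and inj: "\<And>C D u v. C \<in> I \<Longrightarrow> D \<in> I \<Longrightarrow> u \<in> P C \<Longrightarrow> v \<in> P D \<Longrightarrow> c C \<otimes> u = c D \<otimes> v \<Longrightarrow> C = D \<and> u = v"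
    by metis
  interpret Q: schreier_domain G S "H n" Q by (rule Q)
  let ?conj = "\<lambda>C m. c C \<otimes> m \<otimes> inv (c C)"
  have conj: "(c C \<otimes> fst e, snd e) \<in> Q.leaving_edges \<and>
      Q.gen (c C \<otimes> fst e, snd e) = ?conj C (?gen C e) \<and> fst e \<in> P C"
    if C: "C \<in> I" and e: "e \<in> ?E C" for C e
  proof -
    have P': "fst e \<in> P C" "schreier_domain.rep G (stab C) (R C) (fst e \<otimes> snd e) \<in> P C"
      using P [OF C] e by (auto simp: U_def)
    then have "c C \<otimes> fst e \<in> Q" "c C \<otimes> schreier_domain.rep G (stab C) (R C) (fst e \<otimes> snd e) \<in> Q"
      using c [OF C] by blast+
    moreover have e': "(fst e, snd e) \<in> ?E C" using e by simp
    ultimately show ?thesis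
      using schreier_gen_conjugate [OF R [OF Ip(1) [OF C]] Q _ _ e', of "c C"] c [OF C] P'(1)
        conj_stab_in_H [OF Ip(1) [OF C]] by auto
  qed
  let ?B = "{x \<in> carrier G. (\<phi> ^^ n) x \<in> Q.gen ` Q.leaving_edges}"
  \<comment> \<open>The block of \<open>C\<close> in the pulled-back basis \<open>?B\<close>;
    \<open>\<phi> ^^ n\<close> maps it onto the conjugated Schreier generators of
    \<open>stab C\<close>.\<close>
  define \<beta> where "\<beta> C = {x \<in> carrier G. (\<phi> ^^ n) x \<in> ?conj C ` ?gen C ` ?E C}" for C
  have basis_B: "free_basis G ?B"
    using free_basis_vimage [OF funpow_hom funpow_inj Q.free_set_gen] Q.generate_gen
    by (simp add: iterated_image_def)
  have conj_sub: "?conj C ` ?gen C ` ?E C \<subseteq> Q.gen ` Q.leaving_edges" if "C \<in> I" for C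
  proof clarify
    fix e assume "e \<in> ?E C"
    then show "?conj C (?gen C e) \<in> Q.gen ` Q.leaving_edges"
      using conj [OF that, of e] by (metis imageI)
  qed
  have \<beta>_sub: "\<beta> C \<subseteq> ?B" if "C \<in> I" for C using conj_sub [OF that] by (auto simp: \<beta>_def)
  have img: "(\<phi> ^^ n) ` \<beta> C = ?conj C ` ?gen C ` ?E C" if "C \<in> I" for C
  proof -
    have "Q.gen ` Q.leaving_edges \<subseteq> (\<phi> ^^ n) ` carrier G"
      using Q.gen_in_H by (auto simp: iterated_image_def)
    then show ?thesis unfolding \<beta>_def using conj_sub [OF that] by (intro image_Collect_mem) blast
  qed
  have disj: "\<beta> C \<inter> \<beta> D = {}" if CD: "C \<in> I" "D \<in> I" "C \<noteq> D" for C D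
  proof (rule ccontr)
    assume "\<beta> C \<inter> \<beta> D \<noteq> {}"
    then obtain x where "(\<phi> ^^ n) x \<in> ?conj C ` ?gen C ` ?E C" "(\<phi> ^^ n) x \<in> ?conj D ` ?gen D ` ?E D"
      unfolding \<beta>_def by blast
    then obtain e e' where e: "e \<in> ?E C" "e' \<in> ?E D"
        and "(\<phi> ^^ n) x = ?conj C (?gen C e)" "(\<phi> ^^ n) x = ?conj D (?gen D e')"
      by blast
    then have "?conj C (?gen C e) = ?conj D (?gen D e')" by simp
    then have "Q.gen (c C \<otimes> fst e, snd e) = Q.gen (c D \<otimes> fst e', snd e')"
      using conj [OF CD(1) e(1)] conj [OF CD(2) e(2)] by simp
    then have "(c C \<otimes> fst e, snd e) = (c D \<otimes> fst e', snd e')"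
      using inj_onD [OF Q.inj_on_gen] conj [OF CD(1) e(1)] conj [OF CD(2) e(2)] by blast
    then show False
      using inj [OF CD(1,2), of "fst e" "fst e'"] conj [OF CD(1) e(1)] conj [OF CD(2) e(2)] CD(3) by simp
  qed
  \<comment> \<open>The translated point has component \<open>H n\<close> at level \<open>n\<close>,
    which makes it an \<open>n\<close>-fold shift.\<close>
  have "\<exists>\<eta>. point \<eta> \<and> (shift ^^ n) \<eta> = translate (c C) C" if "C \<in> I" for C
    using funpow_shift_surj [OF point_translate [OF Ip(1) [OF that]]] c [OF that] by blast
  then obtain \<eta> where \<eta>: "\<And>C. C \<in> I \<Longrightarrow> point (\<eta> C) \<and> (shift ^^ n) (\<eta> C) = translate (c C) C"
    by metis
  have gen_\<beta>: "generate G (\<beta> C) = stab (\<eta> C)" if C: "C \<in> I" for C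
  proof -
    have cc: "c C \<in> carrier G" using c C by blast
    have gc: "?gen C ` ?E C \<subseteq> carrier G"
      using schreier_domain.gen_closed [OF R [OF Ip(1) [OF C]]] by blast
    have \<beta>c: "\<beta> C \<subseteq> carrier G" by (auto simp: \<beta>_def)
    have "(\<phi> ^^ n) ` generate G (\<beta> C) = generate G (?conj C ` ?gen C ` ?E C)"
      unfolding img [OF C, symmetric] by (rule generate_hom_image [OF funpow_hom \<beta>c, symmetric])
    also have "\<dots> = ?conj C ` stab C"
      using generate_hom_image [OF conj_hom [OF cc] gc] generate_stab [OF Ip(1) [OF C]] by simp
    also have "\<dots> = stab (translate (c C) C)"
      using stab_translate [OF Ip(1) [OF C] cc] conj_subgroup_eq_image [OF stab_closed cc] by simp
    also have "\<dots> = (\<phi> ^^ n) ` stab (\<eta> C)"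
      using \<eta> [OF C] stab_funpow_shift by metis
    finally show ?thesis
      using inj_on_image_eq_iff [OF funpow_inj generate_incl [OF \<beta>c] stab_closed] by blast
  qed
  have nontriv: "stab (\<eta> C) \<noteq> {\<one>}" if C: "C \<in> I" for C
  proof
    assume "stab (\<eta> C) = {\<one>}"
    then have "stab (translate (c C) C) = {\<one>}"
      using stab_funpow_shift [of "\<eta> C" n] \<eta> [OF C] hom_one [OF funpow_hom is_group is_group] by simp
    then have "conj_subgroup G (c C) (stab C) = {\<one>}"
      using stab_translate Ip(1) C c by simp
    then have "?conj C ` stab C = {\<one>}" using conj_subgroup_eq_image [OF stab_closed] c C by metis
    have "m = \<one>" if m: "m \<in> stab C" for m
    proof -
      have mc: "m \<in> carrier G" "c C \<in> carrier G" using m stab_closed c C by auto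
      have "?conj C m = \<one>" using m \<open>?conj C ` stab C = {\<one>}\<close> by blast
      moreover have "m = inv (c C) \<otimes> ?conj C m \<otimes> c C" using mc by (simp add: group_word_simps)
      ultimately show "m = \<one>" using mc by simp
    qed
    then have "stab C = {\<one>}" using subgroup.one_closed [OF subgroup_stab [OF Ip(1) [OF C]]] by blast
    then show False using Ip(2) [OF C] by blast
  qed
  \<comment> \<open>Components index themselves, so distinct points need distinct stabilizers: a
    letter of the nonempty block \<open>\<beta> C\<close> is not generated by the disjoint block
    \<open>\<beta> D\<close>.\<close>
  have inj_st: "inj_on (\<lambda>C. stab (\<eta> C)) I"
  proof (rule inj_onI, rule ccontr)
    fix C D assume CD: "C \<in> I" "D \<in> I" "stab (\<eta> C) = stab (\<eta> D)" "C \<noteq> D"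
    have "\<beta> C \<noteq> {}"
      using img [OF CD(1)] ne [OF Ip [OF CD(1)]] by auto
    then obtain b where b: "b \<in> \<beta> C" by blast
    then have "b \<in> generate G (\<beta> D)" using gen_\<beta> CD generate.incl [of b "\<beta> C" G] by simp
    moreover have "b \<in> ?B" using b \<beta>_sub CD by blast
    moreover have "free_set ?B" using basis_B by (simp add: free_basis_iff)
    ultimately have "b \<in> \<beta> D" using free_set_incl_generate \<beta>_sub CD by blast
    then show False using disj CD b by blast
  qed
  let ?J = "\<eta> ` I"
  have "finite ?J" using I by (simp add: good_def)
  moreover have "\<forall>C\<in>?J. point C \<and> stab C \<noteq> {\<one>}" using \<eta> nontriv by blast
  moreover have "inequivalent ?J"
  proof -
    have eq: "C = D" if CD: "C \<in> I" "D \<in> I" "f \<in> carrier G" "\<eta> C = translate f (\<eta> D)" for C D f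
    proof -
      have "translate (c C) C = translate ((\<phi> ^^ n) f) (translate (c D) D)"
        using \<eta> CD translate_funpow_shift by metis
      then have "translate (c C) C = translate ((\<phi> ^^ n) f \<otimes> c D) D"
        using Ip c CD by (simp add: translate_translate)
      then have "translate (inv (c C)) (translate (c C) C) =
          translate (inv (c C)) (translate ((\<phi> ^^ n) f \<otimes> c D) D)" by simp
      then have "C = translate (inv (c C) \<otimes> ((\<phi> ^^ n) f \<otimes> c D)) D"
        using Ip c CD by (simp add: translate_translate)
      then show ?thesis using Iineq CD c by (meson funpow_closed inv_closed m_closed)
    qed
    show ?thesis
      unfolding inequivalent_def
    proof (intro ballI impI)
      fix p q f assume XY: "p \<in> ?J" "q \<in> ?J" "f \<in> carrier G" "p = translate f q"
      obtain C where C: "C \<in> I" "p = \<eta> C" using XY(1) by (rule imageE)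
      obtain D where D: "D \<in> I" "q = \<eta> D" using XY(2) by (rule imageE)
      have "\<eta> C = translate f (\<eta> D)" using XY(4) by (simp only: C(2) D(2))
      then have "C = D" by (rule eq [OF C(1) D(1) XY(3)])
      then show "p = q" by (simp only: C(2) D(2))
    qed
  qed
  \<comment> \<open>\<open>I\<close> represents the orbit of the shifted point, which also contains
    the \<open>n\<close>-fold shift of \<open>\<eta> C\<close>; injectivity of the shift on orbits
    brings the relation back to \<open>D\<close> and \<open>\<eta> C\<close>.\<close>
  moreover have "\<exists>C\<in>?J. \<exists>f\<in>carrier G. D = translate f C" if D: "point D" "stab D \<noteq> {\<one>}" for D
  proof -
    have "stab ((shift ^^ n) D) \<noteq> {\<one>}"
    proof
      assume "stab ((shift ^^ n) D) = {\<one>}"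
      then have "(\<phi> ^^ n) ` stab D = (\<phi> ^^ n) ` {\<one>}"
        using D stab_funpow_shift hom_one [OF funpow_hom is_group is_group] by simp
      then show False
        using D(2) inj_on_image_eq_iff [OF funpow_inj stab_closed, of "{\<one>}"] by auto
    qed
    then obtain C f where C: "C \<in> I" "f \<in> carrier G" "(shift ^^ n) D = translate f C"
      using rep point_funpow_shift D by blast
    have pt: "point ((shift ^^ n) (\<eta> C))" using \<eta> C point_funpow_shift by blast
    have cc: "inv (c C) \<in> carrier G" using c C by simp
    have "C = translate (inv (c C)) ((shift ^^ n) (\<eta> C))"
      using \<eta> c C Ip by (simp add: translate_translate)
    then have "(shift ^^ n) D = translate f (translate (inv (c C)) ((shift ^^ n) (\<eta> C)))"
      using C(3) by simp
    then have "(shift ^^ n) D = translate (f \<otimes> inv (c C)) ((shift ^^ n) (\<eta> C))"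
      by (simp only: translate_translate [OF pt C(2) cc])
    then show ?thesis
      using funpow_shift_eq_translateD [OF D(1), of "\<eta> C" "f \<otimes> inv (c C)" n] \<eta> C c by blast
  qed
  moreover have "inj_on stab ?J" using inj_st by (auto simp: inj_on_def)
  moreover have "nontrivial_free_factor_system G (stab ` ?J)" if "?J \<noteq> {}"
  proof (rule nontrivial_free_factor_system_blocks [OF basis_B])
    let ?i = "inv_into I (\<lambda>C. stab (\<eta> C))"
    have i: "?i (stab (\<eta> C)) = C" if "C \<in> I" for C using inj_st that by (rule inv_into_f_f)
    show "finite (stab ` ?J)" "stab ` ?J \<noteq> {}" using I that by (auto simp: good_def)
    fix A assume "A \<in> stab ` ?J"
    then obtain C where C: "C \<in> I" "A = stab (\<eta> C)" by blast
    then show "\<beta> (?i A) \<subseteq> ?B" "A = generate G (\<beta> (?i A))" "A \<noteq> {\<one>}"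
      using i \<beta>_sub gen_\<beta> nontriv by auto
    fix A' assume "A' \<in> stab ` ?J" "A \<noteq> A'"
    then obtain D where "D \<in> I" "A' = stab (\<eta> D)" by blast
    then show "\<beta> (?i A) \<inter> \<beta> (?i A') = {}" using C i disj \<open>A \<noteq> A'\<close> by auto
  qed
  ultimately show ?thesis by blast
qed

section \<open>The maximal fixed free factor system\<close>

lemma \<phi>_conj_subgroup:
  assumes "A \<subseteq> carrier G" "x \<in> carrier G"
  shows "\<phi> ` conj_subgroup G x A = conj_subgroup G (\<phi> x) (\<phi> ` A)"
proof -
  interpret \<phi>: group_hom G G \<phi>
    using hom_\<phi> by (simp add: group_hom_def group_hom_axioms_def is_group)
  have "\<phi> (x \<otimes> a \<otimes> inv x) = \<phi> x \<otimes> \<phi> a \<otimes> inv (\<phi> x)" if "a \<in> A" for a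
    using assms that by (auto simp: subset_iff)
  then show ?thesis
    using assms by (simp add: conj_subgroup_eq_image \<phi>_image_subset image_image cong: image_cong_simp)
qed

text \<open>Since \<open>\<sigma>\<close> is onto, every component is, up to conjugation, the image
  of another one, and this repeats \<open>n\<close> times. Hence each component lies in a conjugate
  of every \<open>H n\<close>.\<close>

lemma fixed_system_component:
  assumes fixed: "fixed_system G \<phi> \<B>" and sub: "\<And>B. B \<in> \<B> \<Longrightarrow> B \<subseteq> carrier G"
  shows "B \<in> \<B> \<Longrightarrow> \<exists>B'\<in>\<B>. \<exists>x\<in>carrier G. B = conj_subgroup G x ((\<phi> ^^ n) ` B')"
proof (induction n arbitrary: B)
  case 0
  then have "B = conj_subgroup G \<one> B"
    using sub by (force simp: conj_subgroup_eq_image subset_iff image_iff)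
  then show ?case using 0 by auto
next
  case (Suc n)
  obtain \<sigma> where \<sigma>: "bij_betw \<sigma> \<B> \<B>" "\<And>A. A \<in> \<B> \<Longrightarrow> \<exists>x\<in>carrier G. \<phi> ` A = conj_subgroup G x (\<sigma> A)"
    using fixed by (auto simp: fixed_system_def)
  obtain B\<^sub>1 where B\<^sub>1: "B\<^sub>1 \<in> \<B>" "\<sigma> B\<^sub>1 = B" using \<sigma>(1) Suc.prems by (metis bij_betw_iff_bijections)
  obtain x where x: "x \<in> carrier G" "\<phi> ` B\<^sub>1 = conj_subgroup G x B" using \<sigma>(2) B\<^sub>1 by blast
  obtain B' y where B': "B' \<in> \<B>" "y \<in> carrier G" "B\<^sub>1 = conj_subgroup G y ((\<phi> ^^ n) ` B')"
    using Suc.IH [OF B\<^sub>1(1)] by blast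
  have c: "(\<phi> ^^ n) ` B' \<subseteq> carrier G" "(\<phi> ^^ Suc n) ` B' \<subseteq> carrier G"
    using sub [OF B'(1)] funpow_closed [of _ "Suc n"] by (auto simp: subset_iff)
  have Bc: "B \<subseteq> carrier G" using sub Suc.prems by blast
  have one: "conj_subgroup G \<one> B = B"
    using Bc by (force simp: conj_subgroup_eq_image subset_iff image_iff)
  have "B = conj_subgroup G (inv x) (\<phi> ` B\<^sub>1)"
    using x Bc one by (simp add: conj_subgroup_conj_subgroup)
  also have "\<phi> ` B\<^sub>1 = conj_subgroup G (\<phi> y) ((\<phi> ^^ Suc n) ` B')"
    using B' c \<phi>_conj_subgroup [OF c(1) B'(2)] by (simp add: image_comp)
  also have "conj_subgroup G (inv x) \<dots> = conj_subgroup G (inv x \<otimes> \<phi> y) ((\<phi> ^^ Suc n) ` B')"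
    by (rule conj_subgroup_conj_subgroup [OF c(2) inv_closed [OF x(1)] \<phi>_closed [OF B'(2)]])
  finally have "B = conj_subgroup G (inv x \<otimes> \<phi> y) ((\<phi> ^^ Suc n) ` B')" .
  moreover have "inv x \<otimes> \<phi> y \<in> carrier G" using x(1) B'(2) by simp
  ultimately show ?case using B'(1) by blast
qed

theorem exists_fixed_free_factor_system:
  "\<exists>\<A>. free_factor_system G \<A> \<and> fixed_system G \<phi> \<A> \<and>
    (\<forall>g\<in>carrier G. infinite_tail G \<phi> g \<longrightarrow> carries_class G \<A> g) \<and>
    (\<forall>\<B>. (\<forall>B\<in>\<B>. subgroup B G) \<longrightarrow> fixed_system G \<phi> \<B> \<longrightarrow> carries G \<A> \<B>)"
proof -
  obtain J where J: "finite J" "\<And>C. C \<in> J \<Longrightarrow> point C" "\<And>C. C \<in> J \<Longrightarrow> stab C \<noteq> {\<one>}" "inequivalent J"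
    and rep: "\<And>D. point D \<Longrightarrow> stab D \<noteq> {\<one>} \<Longrightarrow> \<exists>C\<in>J. \<exists>f\<in>carrier G. D = translate f C"
    and ffs: "J \<noteq> {} \<Longrightarrow> inj_on stab J" "J \<noteq> {} \<Longrightarrow> nontrivial_free_factor_system G (stab ` J)"
    using exists_representatives by auto
  \<comment> \<open>A nontrivial free factor system has to be nonempty, so the trivial system stands
    in when no point has a nontrivial stabilizer.\<close>
  define \<A> where "\<A> = (if J = {} then trivial_system G else stab ` J)"
  have "free_factor_system G \<A>" using ffs by (simp add: \<A>_def free_factor_system_def)
  have \<phi>_one: "\<phi> \<one> = \<one>" using hom_one [OF hom_\<phi> is_group is_group] .
  have "fixed_system G \<phi> \<A>"
  proof (cases "J = {}")
    case True
    then show ?thesis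
      using \<phi>_one by (auto simp: \<A>_def trivial_system_def fixed_system_def invariant_via_def
          intro!: exI [of _ id] bexI [of _ \<one>])
  next
    case False
    have inj: "inj_on stab J" using ffs(1) False .
    have "\<exists>D\<in>J. \<exists>f\<in>carrier G. shift C = translate f D" if C: "C \<in> J" for C
    proof -
      have "stab (shift C) \<noteq> {\<one>}"
      proof
        assume "stab (shift C) = {\<one>}"
        then have "\<phi> ` stab C = \<phi> ` {\<one>}" using stab_shift J C \<phi>_one by simp
        then show False
          using J(3) [OF C] inj_on_image_eq_iff [OF inj_\<phi> stab_closed, of "{\<one>}"] by auto
      qed
      then show ?thesis using rep point_shift J C by blast
    qed
    then obtain \<tau> where \<tau>: "\<And>C. C \<in> J \<Longrightarrow> \<tau> C \<in> J \<and> (\<exists>f\<in>carrier G. shift C = translate f (\<tau> C))"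
      by metis
    \<comment> \<open>Equal targets put \<open>shift C\<close> and \<open>shift D\<close> in one
      orbit, hence also \<open>C\<close> and \<open>D\<close>. As \<open>J\<close> is finite,
      \<open>\<tau>\<close> is then a permutation.\<close>
    have "inj_on \<tau> J"
    proof (rule inj_onI)
      fix C D assume CD: "C \<in> J" "D \<in> J" "\<tau> C = \<tau> D"
      obtain f g where fg: "f \<in> carrier G" "g \<in> carrier G"
        "shift C = translate f (\<tau> C)" "shift D = translate g (\<tau> C)"
        using \<tau> CD by metis
      have pt: "point C" "point D" "point (\<tau> C)" "point (shift D)" using J \<tau> CD point_shift by auto
      have "\<tau> C = translate (inv g) (shift D)" using translate_eqD [OF pt(4,3) fg(2,4)] .
      then have "shift C = translate f (translate (inv g) (shift D))" using fg(3) by simp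
      then have "shift C = translate (f \<otimes> inv g) (shift D)"
        by (simp only: translate_translate [OF pt(4) fg(1) inv_closed [OF fg(2)]])
      then obtain h where "h \<in> carrier G" "C = translate h D"
        using shift_eq_translateD [OF pt(1,2), of "f \<otimes> inv g"] fg by auto
      then show "C = D" using J(4) CD by (auto simp: inequivalent_def)
    qed
    then have bij: "bij_betw \<tau> J J"
      using J(1) \<tau> by (simp add: bij_betw_def endo_inj_surj image_subset_iff)
    have bij_stab: "bij_betw stab J (stab ` J)" using inj by (simp add: bij_betw_def)
    let ?\<sigma> = "stab \<circ> (\<tau> \<circ> inv_into J stab)"
    have "bij_betw ?\<sigma> (stab ` J) (stab ` J)"
      using bij bij_stab bij_betw_inv_into bij_betw_trans by metis
    moreover have image: "\<exists>x\<in>carrier G. \<phi> ` A = conj_subgroup G x (?\<sigma> A)" if A: "A \<in> stab ` J" for A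
    proof -
      obtain C where C: "C \<in> J" "A = stab C" using A by blast
      obtain f where f: "f \<in> carrier G" "shift C = translate f (\<tau> C)" using \<tau> C by blast
      have "\<phi> ` A = stab (translate f (\<tau> C))" using C J stab_shift f by metis
      also have "\<dots> = conj_subgroup G f (stab (\<tau> C))" using stab_translate f \<tau> C J by blast
      finally show ?thesis using f C inj by auto
    qed
    moreover have "invariant_via G \<phi> (stab ` J) ?\<sigma>"
      unfolding invariant_via_def
    proof (intro ballI conjI)
      fix A assume A: "A \<in> stab ` J"
      then show "?\<sigma> A \<in> stab ` J" using \<tau> inj by auto
      show "\<exists>x\<in>carrier G. \<phi> ` A \<subseteq> conj_subgroup G x (?\<sigma> A)" using image [OF A] by auto
    qed
    ultimately show ?thesis using False unfolding \<A>_def fixed_system_def by auto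
  qed
  \<comment> \<open>One criterion serves both claims: a class with an infinite tail through the
    singleton of its representative, a fixed system through its components.\<close>
  have carried: "\<exists>A\<in>\<A>. \<exists>x\<in>carrier G. B \<subseteq> conj_subgroup G x A"
    if B: "B \<subseteq> carrier G" and tail: "\<And>n. \<exists>x\<in>carrier G. B \<subseteq> conj_subgroup G x (H n)" for B
  proof (cases "B \<subseteq> {\<one>}")
    case True
    have "\<A> \<noteq> {}" by (simp add: \<A>_def trivial_system_def)
    then obtain A where A: "A \<in> \<A>" by blast
    have "subgroup A G" using free_factor_system_subgroup \<open>free_factor_system G \<A>\<close> A .
    then have "\<one> \<in> conj_subgroup G \<one> A"
      by (simp add: mem_conj_subgroup_iff subgroup.subset subgroup.one_closed)
    then show ?thesis using A True by blast
  next
    case False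
    then obtain g where g: "g \<in> B" "g \<noteq> \<one>" by blast
    obtain C where C: "point C" "B \<subseteq> stab C" using tail_fixes_point [OF B g tail] by blast
    then have "stab C \<noteq> {\<one>}" using g by blast
    then obtain D f where D: "D \<in> J" "f \<in> carrier G" "C = translate f D" using rep C by blast
    then have "stab C = conj_subgroup G f (stab D)" using stab_translate J by simp
    moreover have "stab D \<in> \<A>" using D by (auto simp: \<A>_def)
    ultimately show ?thesis using C D by blast
  qed
  have "carries_class G \<A> g" if g: "g \<in> carrier G" "infinite_tail G \<phi> g" for g
  proof -
    have "\<exists>x\<in>carrier G. {g} \<subseteq> conj_subgroup G x (H n)" for n
    \<comment> \<open>Tails speak of \<open>n \<ge> 1\<close> only; at level 0 the subgroup
      \<open>H 0\<close> is the whole group.\<close>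
    proof (cases "n = 0")
      case True
      then show ?thesis using g H_0 by (intro bexI [of _ \<one>]) (auto simp: mem_conj_subgroup_iff)
    next
      case False
      then have "n \<ge> 1" by simp
      then obtain h where h: "h \<in> carrier G" "conj_class G ((\<phi> ^^ n) h) = conj_class G g"
        using g(2) unfolding infinite_tail_def by blast
      have "g = \<one> \<otimes> g \<otimes> inv \<one>" using g by simp
      then have "g \<in> conj_class G g" unfolding conj_class_def by blast
      then obtain x where x: "x \<in> carrier G" "g = x \<otimes> (\<phi> ^^ n) h \<otimes> inv x"
        using h(2) by (auto simp: conj_class_def)
      have "(\<phi> ^^ n) h \<in> H n" using h by (simp add: iterated_image_def)
      then have "g \<in> conj_subgroup G x (H n)"
        using x h H_closed by (auto simp: conj_subgroup_eq_image)
      then show ?thesis using x by blast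
    qed
    then show ?thesis using carried [of "{g}"] g by (auto simp: carries_class_def)
  qed
  moreover have "carries G \<A> \<B>" if \<B>: "\<forall>B\<in>\<B>. subgroup B G" "fixed_system G \<phi> \<B>" for \<B>
    unfolding carries_def
  proof
    fix B assume B: "B \<in> \<B>"
    have sub: "A \<subseteq> carrier G" if "A \<in> \<B>" for A using \<B> that subgroup.subset by blast
    show "\<exists>A\<in>\<A>. \<exists>x\<in>carrier G. B \<subseteq> conj_subgroup G x A"
    proof (rule carried [OF sub [OF B]])
      fix n
      obtain B' x where B': "B' \<in> \<B>" "x \<in> carrier G" "B = conj_subgroup G x ((\<phi> ^^ n) ` B')"
        using fixed_system_component [OF \<B>(2) sub B] by blast
      have "(\<phi> ^^ n) ` B' \<subseteq> H n" using sub [OF B'(1)] by (auto simp: iterated_image_def)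
      then have "B \<subseteq> conj_subgroup G x (H n)"
        using B' by (auto simp: conj_subgroup_def l_coset_def r_coset_def)
      then show "\<exists>x\<in>carrier G. B \<subseteq> conj_subgroup G x (H n)" using B' by blast
    qed
  qed
  ultimately show ?thesis
    using \<open>free_factor_system G \<A>\<close> \<open>fixed_system G \<phi> \<A>\<close> by blast
qed

end

theorem proposition0p2p3:
  fixes F :: "('a, 'm) monoid_scheme" and S :: "'a set" and \<phi> :: "'a \<Rightarrow> 'a"
  assumes "group F"
    and "free_basis F S" and "finite S" and "card S \<ge> 2"
    and "\<phi> \<in> hom F F" and "inj_on \<phi> (carrier F)"
  shows "\<exists>\<A>. maximal_fixed_free_factor_system F \<phi> \<A> \<and>
    (\<forall>\<B>. maximal_fixed_free_factor_system F \<phi> \<B> \<longrightarrow> equivalent_systems F \<A> \<B>) \<and>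
    (\<forall>g\<in>carrier F. infinite_tail F \<phi> g \<longrightarrow> carries_class F \<A> g) \<and>
    (\<forall>\<B>. subgroup_system F \<B> \<longrightarrow> finitely_generated_system F \<B> \<longrightarrow> fixed_system F \<phi> \<B> \<longrightarrow>
      carries F \<A> \<B>)"
proof -
  interpret group F by fact
  interpret free_group_injection F S \<phi>
    by unfold_locales (use assms in auto)
  obtain \<A> where \<A>: "free_factor_system F \<A>" "fixed_system F \<phi> \<A>"
    "\<forall>g\<in>carrier F. infinite_tail F \<phi> g \<longrightarrow> carries_class F \<A> g"
    and carries: "\<And>\<B>. (\<forall>B\<in>\<B>. subgroup B F) \<Longrightarrow> fixed_system F \<phi> \<B> \<Longrightarrow> carries F \<A> \<B>"
    using exists_fixed_free_factor_system by blast
  \<comment> \<open>Thus \<open>\<A>\<close> is a greatest element among the fixed free factor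
    systems, from which both maximality and uniqueness follow.\<close>
  have carries_ffs: "carries F \<A> \<B>" if "free_factor_system F \<B>" "fixed_system F \<phi> \<B>" for \<B>
    using carries that free_factor_system_subgroup by blast
  have "maximal_fixed_free_factor_system F \<phi> \<A>"
    using \<A> carries_ffs by (auto simp: maximal_fixed_free_factor_system_def equivalent_systems_def)
  moreover have "equivalent_systems F \<A> \<B>" if "maximal_fixed_free_factor_system F \<phi> \<B>" for \<B>
    using that \<A> carries_ffs by (auto simp: maximal_fixed_free_factor_system_def equivalent_systems_def)
  moreover have "carries F \<A> \<B>" if "subgroup_system F \<B>" "fixed_system F \<phi> \<B>" for \<B>
    using that triv_subgroup
    by (intro carries) (auto simp: subgroup_system_def nontrivial_subgroup_system_def trivial_system_def)
  ultimately show ?thesis using \<A> by blast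
qed

end
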